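(* Let $\mathbb{F}$ be a subfield of $\mathbb{C}$, equipped with the topology inherited from $\mathbb{C}$. (1) If $\mathbb{F}$ is dense in $\mathbb{C}$, then for every $n\in\mathbb{N}$ with $n\ge 1$, $\mathrm{ST}^+(n,\mathbb{F})$ is minimal if and only if $\langle\rho_m\rangle\cap\mathbb{F}\neq\{1\}$ for every integer $m>1$ dividing $n$. (2) If $\mathbb{F}\subseteq\mathbb{R}$, then $\mathrm{ST}^+(n,\mathbb{F})$ is minimal for every $n\in\mathbb{N}$ with $n\ge 1$.
   Context: All topological groups are Hausdorff. For $m\ge 1$, $\rho_m=e^{2\pi i/m}$ is the $m$-th primitive root of unity and $\langle\rho_m\rangle$ is the (multiplicative) cyclic group it generates. $\mathrm{ST}^+(n,\mathbb{F})$ denotes the group of upper triangular $n\times n$ matrices over $\mathbb{F}$ of determinant $1$, with the topology inherited from $\mathbb{F}^{n^2}$. A topological group $G$ is minimal if every continuous group isomorphism $f\colon G\to H$ onto a (Hausdorff) topological group $H$ is a topological isomorphism; equivalently, if $G$ admits no strictly coarser Hausdorff group topology. *)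

theory Defs
  imports
    "HOL-Analysis.Analysis"
    "HOL-Algebra.Algebraic_Closure_Type"
    "Jordan_Normal_Form.Determinant"
begin

definition topological_group :: "('a, 'b) monoid_scheme \<Rightarrow> 'a topology \<Rightarrow> bool" where
  "topological_group G T \<longleftrightarrow>
     Group.group G \<and> topspace T = carrier G \<and> Hausdorff_space T \<and>
     continuous_map (prod_topology T T) T (\<lambda>(x, y). x \<otimes>\<^bsub>G\<^esub> y) \<and>
     continuous_map T T (\<lambda>x. inv\<^bsub>G\<^esub> x)"

text \<open>Minimality is stated as the absence of a strictly coarser Hausdorff group topology, because the
  equivalent formulation by continuous isomorphisms onto arbitrary groups would have to quantify
  over the types of those groups. The two lemmas after the definition show that nothing is lost:
  minimality gives the isomorphism property for targets of every type, and the isomorphism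
  property for targets of the same type gives minimality.\<close>

definition minimal_topological_group :: "('a, 'b) monoid_scheme \<Rightarrow> 'a topology \<Rightarrow> bool" where
  "minimal_topological_group G T \<longleftrightarrow>
     topological_group G T \<and>
     (\<forall>T'. topological_group G T' \<and> (\<forall>U. openin T' U \<longrightarrow> openin T U) \<longrightarrow> T' = T)"

lemma minimal_topological_group_iso:
  fixes G :: "('a, 'b) monoid_scheme" and H :: "('c, 'd) monoid_scheme"
  assumes min: "minimal_topological_group G T"
    and H: "topological_group H S"
    and f: "f \<in> Group.iso G H" "continuous_map T S f"
  shows "homeomorphic_map T S f"
proof -
  have G: "topological_group G T" using min by (simp add: minimal_topological_group_def)
  interpret G: Group.group G using G by (simp add: topological_group_def)
  interpret H: Group.group H using H by (simp add: topological_group_def)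
  interpret f: group_hom G H f
    using f(1) by unfold_locales (simp add: Group.iso_def)
  have tS: "topspace S = carrier H" and tT: "topspace T = carrier G"
    using G H by (auto simp: topological_group_def)
  have bij: "bij_betw f (carrier G) (carrier H)"
    using f(1) by (simp add: Group.iso_def)
  define T' where "T' = pullback_topology (carrier G) f S"
  have tT': "topspace T' = carrier G"
    using bij by (auto simp: T'_def topspace_pullback_topology tS bij_betw_def)
  have fT': "continuous_map T' S f"
    using continuous_map_pullback[OF continuous_map_id[of S], of "carrier G" f]
    by (simp add: T'_def)
  have mult: "continuous_map (prod_topology S S) S (\<lambda>(x, y). x \<otimes>\<^bsub>H\<^esub> y)"
    and invS: "continuous_map S S (\<lambda>x. inv\<^bsub>H\<^esub> x)"
    and HS: "Hausdorff_space S"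
    using H by (auto simp: topological_group_def)
  have "continuous_map (prod_topology T' T') T' (\<lambda>(x, y). x \<otimes>\<^bsub>G\<^esub> y)"
  proof (rule continuous_map_pullback'[of _ S f _ "carrier G", folded T'_def])
    have "continuous_map (prod_topology T' T') (prod_topology S S) (\<lambda>p. (f (fst p), f (snd p)))"
      using continuous_map_compose[OF continuous_map_fst fT']
        continuous_map_compose[OF continuous_map_snd fT']
      by (auto simp: continuous_map_pairwise o_def)
    from continuous_map_compose[OF this mult]
    show "continuous_map (prod_topology T' T') S (f \<circ> (\<lambda>(x, y). x \<otimes>\<^bsub>G\<^esub> y))"
      by (rule continuous_map_eq) (auto simp: tT')
  qed (auto simp: tT')
  moreover have "continuous_map T' T' (\<lambda>x. inv\<^bsub>G\<^esub> x)"
  proof (rule continuous_map_pullback'[of _ S f _ "carrier G", folded T'_def])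
    from continuous_map_compose[OF fT' invS]
    show "continuous_map T' S (f \<circ> (\<lambda>x. inv\<^bsub>G\<^esub> x))"
      by (rule continuous_map_eq) (auto simp: tT')
  qed (auto simp: tT')
  moreover have "Hausdorff_space T'"
    using bij HS fT' by (intro Hausdorff_space_injective_preimage[of S T' f])
      (auto simp: bij_betw_def tT')
  ultimately have "topological_group G T'"
    by (simp add: topological_group_def G.group_axioms tT')
  moreover have "\<forall>U. openin T' U \<longrightarrow> openin T U"
    using f(2) by (auto simp: T'_def openin_pullback_topology continuous_map_def tT
        vimage_def Int_def Collect_conj_eq[symmetric] conj_commute)
  ultimately have T: "T' = T"
    using min by (simp add: minimal_topological_group_def)
  have "open_map T S f"
    unfolding open_map_def
  proof (intro allI impI)
    fix U assume "openin T U"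
    then obtain V where V: "openin S V" "U = f -` V \<inter> carrier G"
      by (auto simp: T[symmetric] T'_def openin_pullback_topology)
    moreover have "V \<subseteq> f ` carrier G"
      using openin_subset[OF V(1)] bij by (simp add: tS bij_betw_def)
    ultimately have "f ` U = V" by auto
    with V show "openin S (f ` U)" by simp
  qed
  with f(2) bij show ?thesis
    by (intro bijective_open_imp_homeomorphic_map) (auto simp: tS tT bij_betw_def)
qed

lemma minimal_topological_groupI:
  fixes G :: "('a, 'b) monoid_scheme"
  assumes G: "topological_group G T"
    and iso: "\<And>(H :: ('a, 'b) monoid_scheme) S f. topological_group H S \<Longrightarrow> f \<in> Group.iso G H \<Longrightarrow>
      continuous_map T S f \<Longrightarrow> homeomorphic_map T S f"
  shows "minimal_topological_group G T"
  unfolding minimal_topological_group_def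
proof (intro conjI G allI impI)
  fix T' assume *: "topological_group G T' \<and> (\<forall>U. openin T' U \<longrightarrow> openin T U)"
  have ts: "topspace T = carrier G" "topspace T' = carrier G"
    using G * by (auto simp: topological_group_def)
  have "continuous_map T T' id"
    unfolding continuous_map_def
  proof (intro conjI allI impI)
    fix U assume U: "openin T' U"
    then have "{x \<in> topspace T. id x \<in> U} = U"
      using openin_subset[OF U] by (auto simp: ts)
    with U * show "openin T {x \<in> topspace T. id x \<in> U}" by simp
  qed (auto simp: ts)
  moreover have "id \<in> Group.iso G G" by (simp add: Group.iso_set_refl id_def)
  ultimately have "homeomorphic_map T T' id"
    using * by (intro iso) auto
  then have "open_map T T' id" by (simp add: homeomorphic_eq_everything_map)
  with * show "T' = T" by (auto simp: topology_eq open_map_def)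
qed

definition ST_plus :: "nat \<Rightarrow> complex set \<Rightarrow> complex mat monoid" where
  "ST_plus n F =
     \<lparr> carrier = {A \<in> carrier_mat n n. (\<forall>i<n. \<forall>j<n. A $$ (i, j) \<in> F) \<and>
         upper_triangular A \<and> Determinant.det A = 1},
       monoid.mult = (\<lambda>A B. A * B),
       one = 1\<^sub>m n \<rparr>"

text \<open>The subspace topology of the space of all n by n matrices over F, identified with a product of
  copies of F (with its topology from the complex plane) via the matrix entries.\<close>

definition ST_plus_topology :: "nat \<Rightarrow> complex set \<Rightarrow> complex mat topology" where
  "ST_plus_topology n F =
     pullback_topology (carrier (ST_plus n F))
       (\<lambda>A. \<lambda>p \<in> {..<n} \<times> {..<n}. A $$ p)
       (product_topology (\<lambda>_. top_of_set F) ({..<n} \<times> {..<n}))"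

lemma topspace_ST_plus_topology: "topspace (ST_plus_topology n F) = carrier (ST_plus n F)"
  by (auto simp: ST_plus_topology_def topspace_pullback_topology ST_plus_def)

definition rho :: "nat \<Rightarrow> complex" where
  "rho m = exp (2 * complex_of_real pi * \<i> / of_nat m)"

definition rho_group :: "nat \<Rightarrow> complex set" where
  "rho_group m = range (\<lambda>k::int. rho m powi k)"

end

theory Submission
  imports Defs
begin

text \<open>
  Let \<open>T'\<close> be a Hausdorff group topology coarser than the usual one, and consider matrices
  that tend to the identity with respect to \<open>T'\<close>. Diagonal matrices act on the entries of the
  first row by scaling, and the scaling factors may be taken close to 1 in the usual topology.
  This action is jointly continuous, and it forces \<open>T'\<close> to agree with the usual topology on the
  subgroup of matrices that differ from the identity only in the first row
  (\<open>root_element_tendsto_0\<close>, \<open>row_shear_tendsto_0\<close>). Commutators with suitable fixed elements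
  move the other entries into this subgroup. It follows that all ratios of the entries to the
  upper left entry tend to the entries of the identity matrix (\<open>ratio_tendsto\<close>): \<open>T'\<close> can lose
  nothing but a scalar.

  As the determinant is 1, that scalar clusters only at \<open>n\<close>-th roots of unity, and these lie in
  the closure of \<open>F\<close>. Suppose that each nontrivial one of them has a nontrivial power in
  \<open>F\<close>. At a cluster point other than 1, the corresponding powers of the matrices would tend both
  to the identity and to a nontrivial scalar matrix of the group. Hence the scalar tends to 1, and
  \<open>T'\<close> is the usual topology (\<open>minimal_if_roots\<close>).

  Conversely, let \<open>m > 1\<close> divide \<open>n\<close> and suppose that \<open>F\<close> contains no \<open>m\<close>-th root of unity
  except 1. The group over \<open>F\<close> then embeds into the quotient of the group over the complex
  numbers by the scalar \<open>m\<close>-th roots of unity, and inherits a Hausdorff group topology from it.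
  If \<open>F\<close> is dense, nontrivial scalar roots of unity are limits of matrices over \<open>F\<close>, and the
  inherited topology is strictly coarser (\<open>not_minimal_if_no_roots\<close>).

  No completion of the group enters: limits are taken along arbitrary filters inside the group,
  and only the entries of matrices are allowed to converge to numbers outside \<open>F\<close>.
\<close>

section \<open>Limits and group topologies\<close>

lemma limitin_pullback_topology:
  "limitin (pullback_topology A h T) f l \<F> \<longleftrightarrow>
     l \<in> A \<and> (\<forall>\<^sub>F x in \<F>. f x \<in> A) \<and> limitin T (\<lambda>x. h (f x)) (h l) \<F>"
  (is "?L \<longleftrightarrow> ?R")
proof
  assume L: ?L
  from limitin_topspace[OF L] have l: "l \<in> A" "h l \<in> topspace T"
    by (auto simp: topspace_pullback_topology)
  have ev: "\<forall>\<^sub>F x in \<F>. f x \<in> h -` U \<inter> A" if "openin T U" "h l \<in> U" for U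
  proof (rule limitinD[OF L])
    show "openin (pullback_topology A h T) (h -` U \<inter> A)"
      unfolding openin_pullback_topology using that by blast
  qed (use that l in auto)
  from ev[of "topspace T"] l have "\<forall>\<^sub>F x in \<F>. f x \<in> A"
    by (auto elim: eventually_mono)
  moreover have "limitin T (\<lambda>x. h (f x)) (h l) \<F>"
    unfolding limitin_def
  proof (intro conjI allI impI l)
    fix U assume "openin T U \<and> h l \<in> U"
    then have "\<forall>\<^sub>F x in \<F>. f x \<in> h -` U \<inter> A" by (intro ev) auto
    then show "\<forall>\<^sub>F x in \<F>. h (f x) \<in> U" by (auto elim: eventually_mono)
  qed
  ultimately show ?R using l by blast
next
  assume R: ?R
  show ?L unfolding limitin_def
  proof (intro conjI allI impI)
    show "l \<in> topspace (pullback_topology A h T)"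
      using R by (auto simp: topspace_pullback_topology limitin_def)
    fix U assume "openin (pullback_topology A h T) U \<and> l \<in> U"
    then obtain V where V: "openin T V" "U = h -` V \<inter> A" "h l \<in> V"
      by (auto simp: openin_pullback_topology)
    with R have "\<forall>\<^sub>F x in \<F>. h (f x) \<in> V" by (auto simp: limitin_def)
    moreover have "\<forall>\<^sub>F x in \<F>. f x \<in> A" using R by blast
    ultimately show "\<forall>\<^sub>F x in \<F>. f x \<in> U"
      by eventually_elim (auto simp: V)
  qed
qed

lemma Hausdorff_space_pullback_topology:
  assumes "Hausdorff_space T" "inj_on h A"
  shows "Hausdorff_space (pullback_topology A h T)"
proof (rule Hausdorff_space_injective_preimage[OF assms(1)])
  show "continuous_map (pullback_topology A h T) T h"
    using continuous_map_pullback[OF continuous_map_id[of T], of A h] by simp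
  show "inj_on h (topspace (pullback_topology A h T))"
    using assms(2) by (auto simp: topspace_pullback_topology inj_on_def)
qed

text \<open>Continuity is tested on filters throughout. The filters that matter for multiplication live on
  pairs, those that matter for inversion on single elements.\<close>

lemma topological_groupI_limits:
  assumes "Group.group G" "topspace T = carrier G" "Hausdorff_space T"
    and mult: "\<And>(\<F> :: ('a \<times> 'a) filter) a b. limitin T fst a \<F> \<Longrightarrow> limitin T snd b \<F> \<Longrightarrow>
      limitin T (\<lambda>p. fst p \<otimes>\<^bsub>G\<^esub> snd p) (a \<otimes>\<^bsub>G\<^esub> b) \<F>"
    and inv: "\<And>(\<F> :: 'a filter) a. limitin T (\<lambda>x. x) a \<F> \<Longrightarrow>
      limitin T (\<lambda>x. inv\<^bsub>G\<^esub> x) (inv\<^bsub>G\<^esub> a) \<F>"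
  shows "topological_group G T"
  unfolding topological_group_def
proof (intro conjI assms(1-3))
  show "continuous_map (prod_topology T T) T (\<lambda>(x, y). x \<otimes>\<^bsub>G\<^esub> y)"
    unfolding continuous_map_atin
  proof
    fix p assume p: "p \<in> topspace (prod_topology T T)"
    have "limitin T fst (fst p) (atin (prod_topology T T) p)"
      "limitin T snd (snd p) (atin (prod_topology T T) p)"
      using p by (auto intro!: limitin_continuous_map continuous_map_fst continuous_map_snd)
    from mult[OF this] show "limitin T (\<lambda>(x, y). x \<otimes>\<^bsub>G\<^esub> y) (case p of (x, y) \<Rightarrow> x \<otimes>\<^bsub>G\<^esub> y)
        (atin (prod_topology T T) p)"
      by (simp add: split_def)
  qed
  show "continuous_map T T (\<lambda>x. inv\<^bsub>G\<^esub> x)"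
    unfolding continuous_map_atin
    by (intro ballI inv limitin_continuous_map) auto
qed

context
  fixes G :: "('a, 'b) monoid_scheme" and T
  assumes TG: "topological_group G T"
begin

lemma topological_group_limitin_mult:
  assumes "limitin T f a \<F>" "limitin T g b \<F>"
  shows "limitin T (\<lambda>x. f x \<otimes>\<^bsub>G\<^esub> g x) (a \<otimes>\<^bsub>G\<^esub> b) \<F>"
proof -
  have "limitin (prod_topology T T) (\<lambda>x. (f x, g x)) (a, b) \<F>"
    using assms by (simp add: limitin_pairwise o_def)
  moreover have "continuous_map (prod_topology T T) T (\<lambda>(x, y). x \<otimes>\<^bsub>G\<^esub> y)"
    using TG by (simp add: topological_group_def)
  ultimately have "limitin T ((\<lambda>(x, y). x \<otimes>\<^bsub>G\<^esub> y) \<circ> (\<lambda>x. (f x, g x)))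
      ((\<lambda>(x, y). x \<otimes>\<^bsub>G\<^esub> y) (a, b)) \<F>"
    by (rule continuous_map_limit[rotated])
  then show ?thesis by (simp add: o_def)
qed

lemma topological_group_limitin_inv:
  assumes "limitin T f a \<F>"
  shows "limitin T (\<lambda>x. inv\<^bsub>G\<^esub> f x) (inv\<^bsub>G\<^esub> a) \<F>"
proof -
  have "continuous_map T T (\<lambda>x. inv\<^bsub>G\<^esub> x)"
    using TG by (simp add: topological_group_def)
  from continuous_map_limit[OF this assms] show ?thesis by (simp add: o_def)
qed

lemma topological_group_limitin_pow:
  assumes "limitin T f a \<F>"
  shows "limitin T (\<lambda>x. f x [^]\<^bsub>G\<^esub> (k::nat)) (a [^]\<^bsub>G\<^esub> k) \<F>"
proof (induction k)
  case 0
  have "Group.group G" "topspace T = carrier G" using TG by (auto simp: topological_group_def)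
  then show ?case by (simp add: group.is_monoid monoid.one_closed)
next
  case (Suc k)
  then show ?case using topological_group_limitin_mult[OF Suc assms] by simp
qed

end

text \<open>Convergence to a point \<open>a\<close> is carried to convergence to the identity by the left translation
  with the inverse of \<open>a\<close>, so two group topologies can be compared at the identity.\<close>

lemma topological_group_eqI:
  fixes G (structure) and T :: "'a topology"
  assumes G: "topological_group G T" and G': "topological_group G T'"
    and coarser: "\<And>U. openin T' U \<Longrightarrow> openin T U"
    and one: "\<And>(\<F> :: 'a filter) f. limitin T' f \<one>\<^bsub>G\<^esub> \<F> \<Longrightarrow> limitin T f \<one>\<^bsub>G\<^esub> \<F>"
  shows "T' = T"
proof -
  interpret Group.group G using G by (simp add: topological_group_def)
  have tT: "topspace T = carrier G" and tT': "topspace T' = carrier G"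
    using G G' by (auto simp: topological_group_def)
  have "openin T' U" if U: "openin T U" for U
  proof (subst openin_subopen, intro ballI)
    fix a assume a: "a \<in> U"
    then have aG: "a \<in> carrier G" using openin_subset[OF U] tT by auto
    have "limitin T' (\<lambda>x. x) a (nhdsin T' a)"
      using aG unfolding limitin_def eventually_nhdsin tT' by auto
    moreover have "limitin T' (\<lambda>_. inv a) (inv a) (nhdsin T' a)"
      using aG by (simp add: tT')
    ultimately have "limitin T' (\<lambda>x. inv a \<otimes> x) (inv a \<otimes> a) (nhdsin T' a)"
      by (intro topological_group_limitin_mult[OF G'])
    then have "limitin T (\<lambda>x. inv a \<otimes> x) \<one> (nhdsin T' a)"
      using aG by (intro one) simp
    moreover have "limitin T (\<lambda>_. a) a (nhdsin T' a)" using aG by (simp add: tT)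
    ultimately have "limitin T (\<lambda>x. a \<otimes> (inv a \<otimes> x)) (a \<otimes> \<one>) (nhdsin T' a)"
      by (intro topological_group_limitin_mult[OF G])
    then have "\<forall>\<^sub>F x in nhdsin T' a. a \<otimes> (inv a \<otimes> x) \<in> U"
      using U a aG by (auto simp: limitin_def)
    then obtain S where S: "openin T' S" "a \<in> S" "\<And>x. x \<in> S \<Longrightarrow> a \<otimes> (inv a \<otimes> x) \<in> U"
      using aG by (auto simp: eventually_nhdsin tT')
    have "x \<in> U" if "x \<in> S" for x
    proof -
      have "x \<in> carrier G" using that openin_subset[OF S(1)] tT' by auto
      then show ?thesis using S(3)[OF that] aG by (simp add: m_assoc[symmetric])
    qed
    with S show "\<exists>S. openin T' S \<and> a \<in> S \<and> S \<subseteq> U" by blast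
  qed
  with coarser show ?thesis by (auto simp: topology_eq)
qed

text \<open>A function with values in a compact set that fails to converge to \<open>a\<close> stays away from \<open>a\<close> on
  some finer filter; compactness gives a cluster point there, and refining the filter once more
  turns the cluster point into a limit.\<close>

lemma not_tendsto_imp_cluster:
  fixes h :: "'x \<Rightarrow> 'a :: metric_space"
  assumes "compact K" "\<forall>\<^sub>F x in \<F>. h x \<in> K" "\<not> (h \<longlongrightarrow> a) \<F>"
  obtains z \<G> where "z \<noteq> a" "\<G> \<le> \<F>" "\<G> \<noteq> bot" "(h \<longlongrightarrow> z) \<G>"
proof -
  obtain e where e: "0 < e" "\<not> (\<forall>\<^sub>F x in \<F>. dist (h x) a < e)"
    using assms(3) by (auto simp: tendsto_iff)
  define H where "H = inf \<F> (principal {x. e \<le> dist (h x) a})"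
  have far: "\<forall>\<^sub>F x in H. e \<le> dist (h x) a"
    by (simp add: H_def eventually_inf_principal)
  have "H \<noteq> bot"
    using e(2) by (simp add: H_def trivial_limit_def eventually_inf_principal not_le)
  then have "filtermap h H \<noteq> bot" by (simp add: filtermap_bot_iff)
  moreover have "\<forall>\<^sub>F y in filtermap h H. y \<in> K"
    using assms(2) by (simp add: eventually_filtermap H_def eventually_inf_principal eventually_mono)
  ultimately obtain z where z: "inf (nhds z) (filtermap h H) \<noteq> bot"
    using assms(1) unfolding compact_filter by blast
  define \<G> where "\<G> = inf H (filtercomap h (nhds z))"
  have "\<G> \<noteq> bot"
  proof
    assume "\<G> = bot"
    then have "eventually (\<lambda>_. False) \<G>" by simp
    then obtain P Q where PQ: "eventually P H" "eventually Q (nhds z)" "\<And>x. P x \<Longrightarrow> Q (h x) \<Longrightarrow> False"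
      unfolding \<G>_def eventually_inf eventually_filtercomap by blast
    have "eventually (\<lambda>y. \<not> Q y) (filtermap h H)"
      unfolding eventually_filtermap using PQ(1) by eventually_elim (use PQ(3) in blast)
    with PQ(2) have "eventually (\<lambda>_. False) (inf (nhds z) (filtermap h H))"
      unfolding eventually_inf by blast
    with z show False by (simp add: trivial_limit_def)
  qed
  moreover have lim: "(h \<longlongrightarrow> z) \<G>"
    unfolding filterlim_iff_le_filtercomap \<G>_def by simp
  moreover have "\<G> \<le> \<F>" by (simp add: \<G>_def H_def le_infI1)
  moreover have "z \<noteq> a"
  proof -
    have "\<forall>\<^sub>F x in \<G>. e \<le> dist (h x) a"
      by (rule filter_leD[OF _ far]) (simp add: \<G>_def)
    then have "e \<le> dist z a"
      by (rule tendsto_lowerbound[OF tendsto_dist[OF lim tendsto_const]]) fact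
    with e(1) show ?thesis by auto
  qed
  ultimately show ?thesis using that by blast
qed

lemma limitin_mono: "limitin S f l \<F> \<Longrightarrow> \<G> \<le> \<F> \<Longrightarrow> limitin S f l \<G>"
  unfolding limitin_def using filter_leD by blast

section \<open>Determinants and adjugates of convergent matrices\<close>

lemma tendsto_det:
  fixes A :: "'a \<Rightarrow> 'b :: {comm_ring_1, real_normed_algebra_1} mat"
  assumes "\<And>x. A x \<in> carrier_mat n n" "B \<in> carrier_mat n n"
    and "\<And>i j. i < n \<Longrightarrow> j < n \<Longrightarrow> ((\<lambda>x. A x $$ (i, j)) \<longlongrightarrow> B $$ (i, j)) \<F>"
  shows "((\<lambda>x. Determinant.det (A x)) \<longlongrightarrow> Determinant.det B) \<F>"
proof -
  have "((\<lambda>x. \<Sum>p | p permutes {0..<n}. signof p * (\<Prod>i = 0..<n. A x $$ (i, p i)))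
      \<longlongrightarrow> (\<Sum>p | p permutes {0..<n}. signof p * (\<Prod>i = 0..<n. B $$ (i, p i)))) \<F>"
    by (intro tendsto_sum tendsto_mult tendsto_const tendsto_prod assms(3))
      (auto simp: permutes_in_image)
  then show ?thesis
    by (simp only: det_def'[OF assms(1)] det_def'[OF assms(2)])
qed

lemma tendsto_adj_mat:
  fixes A :: "'a \<Rightarrow> 'b :: {comm_ring_1, real_normed_algebra_1} mat"
  assumes A: "\<And>x. A x \<in> carrier_mat n n" "B \<in> carrier_mat n n"
    and lim: "\<And>i j. i < n \<Longrightarrow> j < n \<Longrightarrow> ((\<lambda>x. A x $$ (i, j)) \<longlongrightarrow> B $$ (i, j)) \<F>"
    and "i < n" "j < n"
  shows "((\<lambda>x. adj_mat (A x) $$ (i, j)) \<longlongrightarrow> adj_mat B $$ (i, j)) \<F>"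
proof -
  have "((\<lambda>x. Determinant.det (mat_delete (A x) j i)) \<longlongrightarrow> Determinant.det (mat_delete B j i)) \<F>"
  proof (rule tendsto_det[of _ "n - 1"])
    fix k l assume kl: "k < n - 1" "l < n - 1"
    have "mat_delete M j i $$ (k, l) =
        M $$ (if k < j then k else Suc k, if l < i then l else Suc l)"
      if "M \<in> carrier_mat n n" for M :: "'b mat"
      using that kl by (auto simp: mat_delete_def)
    with A kl show "((\<lambda>x. mat_delete (A x) j i $$ (k, l)) \<longlongrightarrow> mat_delete B j i $$ (k, l)) \<F>"
      by (simp add: lim)
  qed (rule mat_delete_carrier, rule A)+
  then have "((\<lambda>x. cofactor (A x) j i) \<longlongrightarrow> cofactor B j i) \<F>"
    unfolding cofactor_def by (intro tendsto_mult tendsto_const)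
  moreover have "adj_mat M $$ (i, j) = cofactor M j i" if "M \<in> carrier_mat n n" for M :: "'b mat"
    using that \<open>i < n\<close> \<open>j < n\<close> by (auto simp: adj_mat_def)
  ultimately show ?thesis using A by simp
qed

section \<open>Subfields of the complex numbers\<close>

locale complex_subfield =
  fixes F :: "complex set"
  assumes subfield: "subfield F (ring_of_type_algebra :: complex ring)"
begin

lemma zero_mem: "0 \<in> F" and one_mem: "1 \<in> F"
  and uminus_mem: "x \<in> F \<Longrightarrow> - x \<in> F"
  and mult_mem: "x \<in> F \<Longrightarrow> y \<in> F \<Longrightarrow> x * y \<in> F"
  and add_mem: "x \<in> F \<Longrightarrow> y \<in> F \<Longrightarrow> x + y \<in> F"
proof -
  interpret ring "ring_of_type_algebra :: complex ring" by blast
  note sub = subringE[OF subfieldE(1)[OF subfield]]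
  show "0 \<in> F" "1 \<in> F" "x \<in> F \<Longrightarrow> y \<in> F \<Longrightarrow> x * y \<in> F" "x \<in> F \<Longrightarrow> y \<in> F \<Longrightarrow> x + y \<in> F"
    using sub(2,3,6,7) by (simp_all add: ring_of_type_algebra_def)
  assume x: "x \<in> F"
  have "\<ominus>\<^bsub>ring_of_type_algebra\<^esub> x = - x"
    by (rule minus_equality) (simp_all add: ring_of_type_algebra_def)
  with sub(5)[OF x] show "- x \<in> F" by simp
qed

lemma inverse_mem:
  assumes "x \<in> F"
  shows "inverse x \<in> F"
proof (cases "x = 0")
  case False
  interpret ring "ring_of_type_algebra :: complex ring" by blast
  let ?y = "inv\<^bsub>ring_of_type_algebra\<^esub> x"
  have "x \<in> F - {\<zero>\<^bsub>ring_of_type_algebra\<^esub>}"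
    using assms False by (simp add: ring_of_type_algebra_def)
  from subfield_m_inv[OF subfield this] have "?y \<in> F" "x * ?y = 1"
    by (simp_all add: ring_of_type_algebra_def)
  then show ?thesis using False by (metis inverse_unique)
qed (simp add: zero_mem)

lemma diff_mem: "x \<in> F \<Longrightarrow> y \<in> F \<Longrightarrow> x - y \<in> F"
  using add_mem uminus_mem by fastforce

lemma divide_mem: "x \<in> F \<Longrightarrow> y \<in> F \<Longrightarrow> x / y \<in> F"
  by (simp add: divide_inverse mult_mem inverse_mem)

lemma power_mem: "x \<in> F \<Longrightarrow> x ^ k \<in> F"
  by (induction k) (simp_all add: one_mem mult_mem)

lemma of_nat_mem: "of_nat k \<in> F"
  by (induction k) (simp_all add: zero_mem one_mem add_mem)

lemma numeral_mem: "numeral k \<in> F"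
  using of_nat_mem[of "numeral k"] by simp

lemma sum_mem: "(\<And>i. i \<in> I \<Longrightarrow> f i \<in> F) \<Longrightarrow> sum f I \<in> F"
  by (induction I rule: infinite_finite_induct) (simp_all add: zero_mem add_mem)

lemma prod_mem: "(\<And>i. i \<in> I \<Longrightarrow> f i \<in> F) \<Longrightarrow> prod f I \<in> F"
  by (induction I rule: infinite_finite_induct) (simp_all add: one_mem mult_mem)

lemmas field_mem = zero_mem one_mem uminus_mem mult_mem add_mem inverse_mem diff_mem divide_mem
  power_mem of_nat_mem numeral_mem

lemma det_mem:
  assumes "A \<in> carrier_mat n n" "\<And>i j. i < n \<Longrightarrow> j < n \<Longrightarrow> A $$ (i, j) \<in> F"
  shows "Determinant.det A \<in> F"
proof -
  have "signof p * (\<Prod>i = 0..<n. A $$ (i, p i)) \<in> F" if "p permutes {0..<n}" for p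
    using that assms(2)
    by (intro mult_mem prod_mem) (auto simp: permutes_in_image sign_def field_mem)
  then show ?thesis
    unfolding det_def'[OF assms(1)] by (intro sum_mem) auto
qed

lemma adj_mat_mem:
  assumes "A \<in> carrier_mat n n" "\<And>i j. i < n \<Longrightarrow> j < n \<Longrightarrow> A $$ (i, j) \<in> F" "i < n" "j < n"
  shows "adj_mat A $$ (i, j) \<in> F"
proof -
  have "mat_delete A j i $$ (k, l) \<in> F" if "k < n - 1" "l < n - 1" for k l
    using assms that by (simp add: mat_delete_def)
  then have "Determinant.det (mat_delete A j i) \<in> F"
    by (rule det_mem[OF mat_delete_carrier[OF assms(1)]])
  then show ?thesis
    using assms by (simp add: adj_mat_def cofactor_def field_mem)
qed

end

text \<open>The product \<open>B * A\<close> is read off column by column: in column \<open>j\<close> below the diagonal, all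
  terms to the left of \<open>j\<close> vanish by induction and all terms to the right of \<open>j\<close> because \<open>A\<close> is
  triangular, so the single remaining term vanishes too.\<close>

lemma upper_triangular_left_inverse:
  fixes A B :: "'a :: idom mat"
  assumes A: "A \<in> carrier_mat n n" "upper_triangular A" "\<And>i. i < n \<Longrightarrow> A $$ (i, i) \<noteq> 0"
    and B: "B \<in> carrier_mat n n" and BA: "B * A = 1\<^sub>m n"
  shows "upper_triangular B"
proof
  fix i j assume "j < i" "i < dim_row B"
  with B have "j < i" "i < n" by auto
  then show "B $$ (i, j) = 0"
  proof (induction j rule: less_induct)
    case (less j)
    have "(\<Sum>k = 0..<n. B $$ (i, k) * A $$ (k, j)) = (B * A) $$ (i, j)"
      using A B less.prems by (simp add: scalar_prod_def)
    also have "\<dots> = 0" using less.prems by (simp add: BA)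
    finally have "0 = (\<Sum>k = 0..<n. B $$ (i, k) * A $$ (k, j))" by simp
    also have "\<dots> = (\<Sum>k = 0..<n. if k = j then B $$ (i, j) * A $$ (j, j) else 0)"
    proof (rule sum.cong[OF refl])
      fix k assume k: "k \<in> {0..<n}"
      consider "k < j" | "k = j" | "j < k" by linarith
      then show "B $$ (i, k) * A $$ (k, j) = (if k = j then B $$ (i, j) * A $$ (j, j) else 0)"
        using k less A upper_triangularD[OF A(2), of j k] by cases auto
    qed
    also have "\<dots> = B $$ (i, j) * A $$ (j, j)" using less.prems by simp
    finally show ?case using A(3)[of j] less.prems by auto
  qed
qed

section \<open>The topological group of upper triangular matrices of determinant one\<close>

locale triangular_group = complex_subfield +
  fixes n :: nat
  assumes n_pos: "n \<ge> 1"
begin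

abbreviation G where "G \<equiv> ST_plus n F"
abbreviation T where "T \<equiv> ST_plus_topology n F"

lemma mult_G: "A \<otimes>\<^bsub>G\<^esub> B = A * B" and one_G: "\<one>\<^bsub>G\<^esub> = 1\<^sub>m n"
  by (simp_all add: ST_plus_def)

text \<open>Membership without determinants: for a triangular matrix the determinant is the product of
  the diagonal.\<close>

lemma carrier_G_iff:
  "A \<in> carrier G \<longleftrightarrow> A \<in> carrier_mat n n \<and> (\<forall>i<n. \<forall>j<n. A $$ (i, j) \<in> F) \<and>
     (\<forall>i j. j < i \<longrightarrow> i < n \<longrightarrow> A $$ (i, j) = 0) \<and> (\<Prod>i<n. A $$ (i, i)) = 1"
proof -
  have "Determinant.det A = (\<Prod>i<n. A $$ (i, i))" if "A \<in> carrier_mat n n" "upper_triangular A"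
    using det_upper_triangular[OF that(2,1)] that(1)
    by (simp add: prod_list_diag_prod atLeast0LessThan)
  moreover have "upper_triangular A \<longleftrightarrow> (\<forall>i j. j < i \<longrightarrow> i < n \<longrightarrow> A $$ (i, j) = 0)"
    if "A \<in> carrier_mat n n"
    using that by (auto simp: upper_triangular_def)
  ultimately show ?thesis by (auto simp: ST_plus_def)
qed

lemma
  assumes "A \<in> carrier G"
  shows carrier_G_mat: "A \<in> carrier_mat n n"
    and carrier_G_dim: "dim_row A = n" "dim_col A = n"
    and carrier_G_mem: "\<And>i j. i < n \<Longrightarrow> j < n \<Longrightarrow> A $$ (i, j) \<in> F"
    and carrier_G_lower: "\<And>i j. j < i \<Longrightarrow> i < n \<Longrightarrow> A $$ (i, j) = 0"
    and carrier_G_diag_prod: "(\<Prod>i<n. A $$ (i, i)) = 1"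
    and carrier_G_diag: "\<And>i. i < n \<Longrightarrow> A $$ (i, i) \<noteq> 0"
    and carrier_G_upper: "upper_triangular A"
    and carrier_G_det: "Determinant.det A = 1"
proof -
  show "\<And>i. i < n \<Longrightarrow> A $$ (i, i) \<noteq> 0"
    using assms unfolding carrier_G_iff by (metis finite_lessThan lessThan_iff prod_zero zero_neq_one)
  show "(\<Prod>i<n. A $$ (i, i)) = 1" "\<And>i j. j < i \<Longrightarrow> i < n \<Longrightarrow> A $$ (i, j) = 0"
    using assms unfolding carrier_G_iff by blast+
qed (use assms in \<open>auto simp: ST_plus_def\<close>)

lemma entries_eqI:
  assumes "A \<in> carrier_mat n n" "B \<in> carrier_mat n n"
    and "\<And>i j. i < n \<Longrightarrow> j < n \<Longrightarrow> A $$ (i, j) = B $$ (i, j)"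
  shows "A = B"
  using assms by (intro eq_matI) auto

lemma mult_entry:
  assumes "A \<in> carrier_mat n n" "B \<in> carrier_mat n n" "i < n" "j < n"
  shows "(A * B) $$ (i, j) = (\<Sum>k<n. A $$ (i, k) * B $$ (k, j))"
  using assms by (simp add: scalar_prod_def atLeast0LessThan)

lemma mult_diag_entry:
  assumes "A \<in> carrier G" "B \<in> carrier G" "i < n"
  shows "(A * B) $$ (i, i) = A $$ (i, i) * B $$ (i, i)"
proof -
  have "(A * B) $$ (i, i) = (\<Sum>k<n. A $$ (i, k) * B $$ (k, i))"
    using assms by (intro mult_entry carrier_G_mat)
  also have "\<dots> = (\<Sum>k<n. if k = i then A $$ (i, i) * B $$ (i, i) else 0)"
  proof (rule sum.cong[OF refl])
    fix k assume "k \<in> {..<n}"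
    then show "A $$ (i, k) * B $$ (k, i) = (if k = i then A $$ (i, i) * B $$ (i, i) else 0)"
      using assms carrier_G_lower[OF assms(1), of k i] carrier_G_lower[OF assms(2), of i k]
      by (cases k i rule: linorder_cases) auto
  qed
  finally show ?thesis using assms by simp
qed

lemma mult_closed:
  assumes A: "A \<in> carrier G" and B: "B \<in> carrier G"
  shows "A * B \<in> carrier G"
  unfolding carrier_G_iff
proof (intro conjI allI impI)
  show "A * B \<in> carrier_mat n n" using A B by (intro mult_carrier_mat[of _ n n] carrier_G_mat)
next
  fix i j assume "i < n" "j < n"
  then show "(A * B) $$ (i, j) \<in> F"
    using A B by (auto simp: mult_entry carrier_G_mat intro!: sum_mem mult_mem carrier_G_mem)
next
  fix i j assume ij: "j < i" "i < n"
  have "A $$ (i, k) * B $$ (k, j) = 0" if "k < n" for k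
    using carrier_G_lower[OF A, of k i] carrier_G_lower[OF B, of j k] ij that by (cases "k < i") auto
  then have "(\<Sum>k<n. A $$ (i, k) * B $$ (k, j)) = 0" by (intro sum.neutral) auto
  with ij show "(A * B) $$ (i, j) = 0"
    using A B by (simp add: mult_entry carrier_G_mat)
next
  show "(\<Prod>i<n. (A * B) $$ (i, i)) = 1"
    using A B by (simp add: mult_diag_entry prod.distrib carrier_G_diag_prod)
qed

lemma adj_mat_inverse:
  assumes A: "A \<in> carrier G"
  shows "adj_mat A \<in> carrier G" "adj_mat A * A = 1\<^sub>m n"
proof -
  note adj = adj_mat[OF carrier_G_mat[OF A]]
  show 1: "adj_mat A * A = 1\<^sub>m n" using adj(3) unfolding carrier_G_det[OF A] by (auto intro!: eq_matI)
  have "upper_triangular (adj_mat A)"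
    by (rule upper_triangular_left_inverse[OF carrier_G_mat[OF A] carrier_G_upper[OF A] _ adj(1) 1])
      (rule carrier_G_diag[OF A])
  moreover have "Determinant.det (adj_mat A) * Determinant.det A = 1"
    using det_mult[OF adj(1) carrier_G_mat[OF A]] by (simp add: 1)
  moreover have "\<forall>i<n. \<forall>j<n. adj_mat A $$ (i, j) \<in> F"
    using adj_mat_mem[OF carrier_G_mat[OF A]] carrier_G_mem[OF A] by blast
  ultimately show "adj_mat A \<in> carrier G"
    using adj(1) carrier_G_det[OF A] by (simp add: ST_plus_def)
qed

lemma group_G: "Group.group G"
proof (rule groupI)
  show "\<one>\<^bsub>G\<^esub> \<in> carrier G" by (auto simp: carrier_G_iff one_G field_mem)
next
  fix A B C assume "A \<in> carrier G" "B \<in> carrier G" "C \<in> carrier G"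
  then show "A \<otimes>\<^bsub>G\<^esub> B \<otimes>\<^bsub>G\<^esub> C = A \<otimes>\<^bsub>G\<^esub> (B \<otimes>\<^bsub>G\<^esub> C)"
    unfolding mult_G by (intro assoc_mult_mat[of _ n n _ n _ n] carrier_G_mat)
next
  fix A assume "A \<in> carrier G"
  then show "\<one>\<^bsub>G\<^esub> \<otimes>\<^bsub>G\<^esub> A = A" "\<exists>B\<in>carrier G. B \<otimes>\<^bsub>G\<^esub> A = \<one>\<^bsub>G\<^esub>"
    using adj_mat_inverse by (auto simp: mult_G one_G left_mult_one_mat[OF carrier_G_mat])
qed (simp add: mult_G mult_closed)

sublocale grp: Group.group G by (rule group_G)

lemma inv_G: "A \<in> carrier G \<Longrightarrow> inv\<^bsub>G\<^esub> A = adj_mat A"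
  using adj_mat_inverse by (intro grp.inv_equality) (auto simp: mult_G one_G)

lemma topspace_T: "topspace T = carrier G"
  by (rule topspace_ST_plus_topology)

lemma limitin_T_iff:
  "limitin T f A \<F> \<longleftrightarrow> A \<in> carrier G \<and> (\<forall>\<^sub>F x in \<F>. f x \<in> carrier G) \<and>
     (\<forall>i<n. \<forall>j<n. ((\<lambda>x. f x $$ (i, j)) \<longlongrightarrow> A $$ (i, j)) \<F>)"
proof -
  have "limitin (product_topology (\<lambda>_. top_of_set F) ({..<n} \<times> {..<n}))
      (\<lambda>x. \<lambda>p\<in>{..<n} \<times> {..<n}. f x $$ p) (\<lambda>p\<in>{..<n} \<times> {..<n}. A $$ p) \<F> \<longleftrightarrow>
     (\<forall>i<n. \<forall>j<n. ((\<lambda>x. f x $$ (i, j)) \<longlongrightarrow> A $$ (i, j)) \<F>)"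
    if "A \<in> carrier G" and ev: "\<forall>\<^sub>F x in \<F>. f x \<in> carrier G"
  proof -
    have 1: "\<forall>\<^sub>F x in \<F>. (\<lambda>p\<in>{..<n} \<times> {..<n}. f x $$ p) \<in> {..<n} \<times> {..<n} \<rightarrow>\<^sub>E F"
      using ev by eventually_elim (auto simp: carrier_G_mem)
    have 2: "\<forall>\<^sub>F x in \<F>. f x $$ (i, j) \<in> F" if "i < n" "j < n" for i j
      using ev by eventually_elim (use that in \<open>auto simp: carrier_G_mem\<close>)
    show ?thesis
      using \<open>A \<in> carrier G\<close> 1 2
      by (auto simp: limitin_componentwise limitin_subtopology carrier_G_mem)
  qed
  then show ?thesis
    unfolding ST_plus_topology_def limitin_pullback_topology by blast
qed

text \<open>Entries of a product are polynomials in the entries of the factors, and the inverse of a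
  matrix of determinant one is its adjugate, whose entries are polynomials as well.\<close>

lemma T_topological_group: "topological_group G T"
proof (rule topological_groupI_limits[OF group_G topspace_T])
  have "inj_on (\<lambda>A. \<lambda>p\<in>{..<n} \<times> {..<n}. A $$ p) (carrier G)"
  proof (rule inj_onI)
    fix A B assume AB: "A \<in> carrier G" "B \<in> carrier G"
      and eq: "(\<lambda>p\<in>{..<n} \<times> {..<n}. A $$ p) = (\<lambda>p\<in>{..<n} \<times> {..<n}. B $$ p)"
    have "A $$ (i, j) = B $$ (i, j)" if "i < n" "j < n" for i j
      using fun_cong[OF eq, of "(i, j)"] that by simp
    with AB show "A = B" by (intro entries_eqI carrier_G_mat)
  qed
  then show "Hausdorff_space T"
    unfolding ST_plus_topology_def
    by (intro Hausdorff_space_pullback_topology)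
      (simp_all add: Hausdorff_space_product_topology Hausdorff_space_subtopology)
next
  fix \<F> :: "(complex mat \<times> complex mat) filter" and A B
  assume lim: "limitin T fst A \<F>" "limitin T snd B \<F>"
  then have ev: "\<forall>\<^sub>F p in \<F>. fst p \<in> carrier G \<and> snd p \<in> carrier G"
    and AB: "A \<in> carrier G" "B \<in> carrier G"
    by (auto simp: limitin_T_iff intro: eventually_conj)
  have "((\<lambda>p. (fst p * snd p) $$ (i, j)) \<longlongrightarrow> (A * B) $$ (i, j)) \<F>" if ij: "i < n" "j < n" for i j
  proof -
    have "((\<lambda>p. \<Sum>k<n. fst p $$ (i, k) * snd p $$ (k, j)) \<longlongrightarrow> (\<Sum>k<n. A $$ (i, k) * B $$ (k, j))) \<F>"
      using lim ij by (intro tendsto_sum tendsto_mult) (auto simp: limitin_T_iff)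
    moreover have "\<forall>\<^sub>F p in \<F>. (\<Sum>k<n. fst p $$ (i, k) * snd p $$ (k, j)) = (fst p * snd p) $$ (i, j)"
      using ev by eventually_elim (use ij in \<open>auto simp: mult_entry carrier_G_mat\<close>)
    ultimately show ?thesis
      using ij AB by (simp add: mult_entry carrier_G_mat tendsto_cong)
  qed
  moreover have "\<forall>\<^sub>F p in \<F>. fst p * snd p \<in> carrier G"
    using ev by eventually_elim (auto intro: mult_closed)
  ultimately show "limitin T (\<lambda>p. fst p \<otimes>\<^bsub>G\<^esub> snd p) (A \<otimes>\<^bsub>G\<^esub> B) \<F>"
    using AB by (auto simp: limitin_T_iff mult_G mult_closed)
next
  fix \<F> :: "complex mat filter" and A
  assume lim: "limitin T (\<lambda>x. x) A \<F>"
  then have ev: "\<forall>\<^sub>F x in \<F>. x \<in> carrier G" and A: "A \<in> carrier G"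
    by (auto simp: limitin_T_iff)
  have "((\<lambda>x. (inv\<^bsub>G\<^esub> x) $$ (i, j)) \<longlongrightarrow> (inv\<^bsub>G\<^esub> A) $$ (i, j)) \<F>" if ij: "i < n" "j < n" for i j
  proof -
    \<comment> \<open>Outside the group \<open>x\<close> is replaced by \<open>A\<close>, since \<open>tendsto_adj_mat\<close> concerns functions
      all of whose values have the same size.\<close>
    let ?c = "\<lambda>x. if x \<in> carrier G then x else A"
    have ev_c: "\<forall>\<^sub>F x in \<F>. x = ?c x" using ev by eventually_elim simp
    have "((\<lambda>x. adj_mat (?c x) $$ (i, j)) \<longlongrightarrow> adj_mat A $$ (i, j)) \<F>"
    proof (rule tendsto_adj_mat[OF _ carrier_G_mat[OF A] _ ij])
      fix k l assume "k < n" "l < n"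
      then have "((\<lambda>x. x $$ (k, l)) \<longlongrightarrow> A $$ (k, l)) \<F>" using lim by (simp add: limitin_T_iff)
      then show "((\<lambda>x. ?c x $$ (k, l)) \<longlongrightarrow> A $$ (k, l)) \<F>"
        by (rule Lim_transform_eventually) (use ev_c in \<open>auto elim: eventually_mono\<close>)
    qed (use A carrier_G_mat in auto)
    then have "((\<lambda>x. (inv\<^bsub>G\<^esub> x) $$ (i, j)) \<longlongrightarrow> adj_mat A $$ (i, j)) \<F>"
      by (rule Lim_transform_eventually) (use ev in \<open>auto elim!: eventually_mono simp: inv_G\<close>)
    then show ?thesis by (simp add: inv_G A)
  qed
  moreover have "\<forall>\<^sub>F x in \<F>. inv\<^bsub>G\<^esub> x \<in> carrier G"
    using ev by eventually_elim auto
  ultimately show "limitin T (\<lambda>x. inv\<^bsub>G\<^esub> x) (inv\<^bsub>G\<^esub> A) \<F>"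
    using A by (auto simp: limitin_T_iff)
qed

end

section \<open>First-row shears and diagonal matrices\<close>

context triangular_group
begin

text \<open>The matrices that differ from the identity only in the first row, off the diagonal. Those with
  entries in \<open>F\<close> form an abelian normal subgroup, on which diagonal matrices act by scaling the
  coordinates.\<close>

definition row_shear :: "(nat \<Rightarrow> complex) \<Rightarrow> complex mat" where
  "row_shear v = mat n n (\<lambda>(i, j). if i = j then 1 else if i = 0 then v j else 0)"

definition diagonal :: "(nat \<Rightarrow> complex) \<Rightarrow> complex mat" where
  "diagonal f = mat n n (\<lambda>(i, j). if i = j then f i else 0)"

abbreviation root_element :: "nat \<Rightarrow> complex \<Rightarrow> complex mat" where
  "root_element j t \<equiv> row_shear (\<lambda>k. if k = j then t else 0)"

lemma row_shear_carrier_mat [simp]: "row_shear v \<in> carrier_mat n n"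
  and diagonal_carrier_mat [simp]: "diagonal f \<in> carrier_mat n n"
  by (simp_all add: row_shear_def diagonal_def)

lemma row_shear_entry:
  "i < n \<Longrightarrow> j < n \<Longrightarrow> row_shear v $$ (i, j) = (if i = j then 1 else if i = 0 then v j else 0)"
  by (simp add: row_shear_def)

lemma diagonal_entry: "i < n \<Longrightarrow> j < n \<Longrightarrow> diagonal f $$ (i, j) = (if i = j then f i else 0)"
  by (simp add: diagonal_def)

lemma row_shear_mem: "(\<And>j. 0 < j \<Longrightarrow> j < n \<Longrightarrow> v j \<in> F) \<Longrightarrow> row_shear v \<in> carrier G"
  by (auto simp: carrier_G_iff row_shear_entry field_mem)

lemma diagonal_mem: "(\<And>i. i < n \<Longrightarrow> f i \<in> F) \<Longrightarrow> (\<Prod>i<n. f i) = 1 \<Longrightarrow> diagonal f \<in> carrier G"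
  by (auto simp: carrier_G_iff diagonal_entry field_mem)

lemma row_shear_cong: "(\<And>j. 0 < j \<Longrightarrow> j < n \<Longrightarrow> u j = v j) \<Longrightarrow> row_shear u = row_shear v"
  by (intro entries_eqI) (auto simp: row_shear_entry)

lemma row_shear_eq_one: "(\<And>j. 0 < j \<Longrightarrow> j < n \<Longrightarrow> v j = 0) \<Longrightarrow> row_shear v = 1\<^sub>m n"
  by (intro entries_eqI) (auto simp: row_shear_entry)

lemma mult_row_shear_entry:
  assumes "A \<in> carrier_mat n n" "i < n" "j < n"
  shows "(A * row_shear v) $$ (i, j) = A $$ (i, j) + (if j = 0 then 0 else A $$ (i, 0) * v j)"
proof -
  have "(A * row_shear v) $$ (i, j) =
      (\<Sum>k<n. (if k = j then A $$ (i, j) else 0) + (if k = 0 then if j = 0 then 0 else A $$ (i, 0) * v j else 0))"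
    unfolding mult_entry[OF assms(1) row_shear_carrier_mat assms(2,3)]
    by (rule sum.cong[OF refl]) (use assms in \<open>auto simp: row_shear_entry\<close>)
  also have "\<dots> = A $$ (i, j) + (if j = 0 then 0 else A $$ (i, 0) * v j)"
    using assms n_pos by (simp add: sum.distrib)
  finally show ?thesis .
qed

lemma root_element_mult_entry:
  assumes "A \<in> carrier_mat n n" "i < n" "k < n" "0 < j" "j < n"
  shows "(root_element j t * A) $$ (i, k) = A $$ (i, k) + (if i = 0 then t * A $$ (j, k) else 0)"
proof -
  have "(root_element j t * A) $$ (i, k) =
      (\<Sum>l<n. (if l = i then A $$ (i, k) else 0) + (if l = j then if i = 0 then t * A $$ (j, k) else 0 else 0))"
    unfolding mult_entry[OF row_shear_carrier_mat assms(1-3)]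
    by (rule sum.cong[OF refl]) (use assms in \<open>auto simp: row_shear_entry\<close>)
  also have "\<dots> = A $$ (i, k) + (if i = 0 then t * A $$ (j, k) else 0)"
    using assms by (simp add: sum.distrib)
  finally show ?thesis .
qed

lemma diagonal_mult_entry:
  assumes "A \<in> carrier_mat n n" "i < n" "j < n"
  shows "(diagonal f * A) $$ (i, j) = f i * A $$ (i, j)"
proof -
  have "(diagonal f * A) $$ (i, j) = (\<Sum>k<n. if k = i then f i * A $$ (i, j) else 0)"
    unfolding mult_entry[OF diagonal_carrier_mat assms]
    by (rule sum.cong[OF refl]) (use assms in \<open>auto simp: diagonal_entry\<close>)
  then show ?thesis using assms by simp
qed

lemma mult_diagonal_entry:
  assumes "A \<in> carrier_mat n n" "i < n" "j < n"
  shows "(A * diagonal f) $$ (i, j) = A $$ (i, j) * f j"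
proof -
  have "(A * diagonal f) $$ (i, j) = (\<Sum>k<n. if k = j then A $$ (i, j) * f j else 0)"
    unfolding mult_entry[OF assms(1) diagonal_carrier_mat assms(2,3)]
    by (rule sum.cong[OF refl]) (use assms in \<open>auto simp: diagonal_entry\<close>)
  then show ?thesis using assms by simp
qed

lemma row_shear_mult: "row_shear u * row_shear v = row_shear (\<lambda>j. u j + v j)"
  by (rule entries_eqI)
    (auto simp: mult_row_shear_entry row_shear_entry intro!: mult_carrier_mat[of _ n n])

lemma row_shear_inv:
  assumes "\<And>j. 0 < j \<Longrightarrow> j < n \<Longrightarrow> v j \<in> F"
  shows "inv\<^bsub>G\<^esub> (row_shear v) = row_shear (\<lambda>j. - v j)"
proof (rule grp.inv_equality)
  show "row_shear (\<lambda>j. - v j) \<otimes>\<^bsub>G\<^esub> row_shear v = \<one>\<^bsub>G\<^esub>"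
    unfolding mult_G row_shear_mult one_G by (rule row_shear_eq_one) simp
qed (use assms in \<open>auto intro!: row_shear_mem simp: field_mem\<close>)

lemma diagonal_conj_row_shear:
  assumes "diagonal f \<in> carrier G" "\<And>j. 0 < j \<Longrightarrow> j < n \<Longrightarrow> v j \<in> F"
  shows "diagonal f \<otimes>\<^bsub>G\<^esub> row_shear v \<otimes>\<^bsub>G\<^esub> inv\<^bsub>G\<^esub> (diagonal f) = row_shear (\<lambda>j. f 0 / f j * v j)"
proof -
  have f: "f j \<noteq> 0" "f j \<in> F" if "j < n" for j
    using carrier_G_diag[OF assms(1) that] carrier_G_mem[OF assms(1) that that] that
    by (simp_all add: diagonal_entry)
  have mem: "row_shear v \<in> carrier G" "row_shear (\<lambda>j. f 0 / f j * v j) \<in> carrier G"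
    using assms f n_pos by (auto intro!: row_shear_mem simp: field_mem)
  have "diagonal f \<otimes>\<^bsub>G\<^esub> row_shear v = row_shear (\<lambda>j. f 0 / f j * v j) \<otimes>\<^bsub>G\<^esub> diagonal f"
    unfolding mult_G
    by (rule entries_eqI[OF mult_carrier_mat[of _ n n] mult_carrier_mat[of _ n n]])
      (use f in \<open>auto simp: diagonal_mult_entry mult_diagonal_entry row_shear_entry\<close>)
  with assms(1) mem show ?thesis by (simp add: grp.m_assoc)
qed

lemma inv_cancel_left: "A \<in> carrier G \<Longrightarrow> B \<in> carrier G \<Longrightarrow> inv\<^bsub>G\<^esub> A \<otimes>\<^bsub>G\<^esub> (A \<otimes>\<^bsub>G\<^esub> B) = B"
  using grp.m_assoc[of "inv\<^bsub>G\<^esub> A" A B] by simp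

lemma two_power_ne_one: "(2 :: complex) ^ n \<noteq> 1"
proof
  assume "(2 :: complex) ^ n = 1"
  then have "norm ((2 :: complex) ^ n) = 1" by simp
  moreover have "(1 :: real) < 2 ^ n" using n_pos by (intro one_less_power) auto
  ultimately show False by (simp add: norm_power)
qed

lemma prod_update_two:
  fixes a b :: complex
  assumes "0 < j" "j < n"
  shows "(\<Prod>i<n. if i = 0 then a else if i = j then b else 1) = a * b"
proof -
  have "(\<Prod>i<n. if i = 0 then a else if i = j then b else 1) =
      (\<Prod>i\<in>{0, j}. if i = 0 then a else if i = j then b else 1)"
    using assms by (intro prod.mono_neutral_right) auto
  then show ?thesis using assms by simp
qed

lemma prod_update_one:
  fixes a b :: complex
  assumes "j < n"
  shows "(\<Prod>i<n. if i = j then a else b) = a * b ^ (n - 1)"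
proof -
  have "(\<Prod>i<n. if i = j then a else b) = a * (\<Prod>i\<in>{..<n} - {j}. if i = j then a else b)"
    using assms by (subst prod.remove[of _ j]) auto
  also have "(\<Prod>i\<in>{..<n} - {j}. if i = j then a else b) = (\<Prod>i\<in>{..<n} - {j}. b)"
    by (rule prod.cong) auto
  finally show ?thesis using assms by simp
qed

text \<open>For two rows these are all the diagonal matrices of determinant one, so in general only
  squares of elements of \<open>F\<close> are available for scaling a root element.\<close>

definition torus :: "nat \<Rightarrow> complex \<Rightarrow> complex mat" where
  "torus j a = diagonal (\<lambda>i. if i = 0 then a else if i = j then inverse a else 1)"

lemma torus_mem:
  assumes "0 < j" "j < n" "a \<in> F" "a \<noteq> 0"
  shows "torus j a \<in> carrier G"
  unfolding torus_def using assms
  by (intro diagonal_mem) (auto simp: prod_update_two field_mem)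

lemma torus_conj_root_element:
  assumes "0 < j" "j < n" "a \<in> F" "a \<noteq> 0" "t \<in> F"
  shows "torus j a \<otimes>\<^bsub>G\<^esub> root_element j t \<otimes>\<^bsub>G\<^esub> inv\<^bsub>G\<^esub> (torus j a) = root_element j (a\<^sup>2 * t)"
proof -
  have "torus j a \<otimes>\<^bsub>G\<^esub> root_element j t \<otimes>\<^bsub>G\<^esub> inv\<^bsub>G\<^esub> (torus j a) =
      row_shear (\<lambda>k. (\<lambda>i. if i = 0 then a else if i = j then inverse a else 1) 0 /
        (\<lambda>i. if i = 0 then a else if i = j then inverse a else 1) k * (if k = j then t else 0))"
    using torus_mem[OF assms(1-4)] assms(5) unfolding torus_def
    by (intro diagonal_conj_row_shear) (auto simp: field_mem)
  also have "\<dots> = root_element j (a\<^sup>2 * t)"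
    using assms by (intro row_shear_cong) (auto simp: power2_eq_square field_simps)
  finally show ?thesis .
qed

end

section \<open>Coarser Hausdorff group topologies\<close>

locale coarser_topology = triangular_group +
  fixes T' :: "complex mat topology"
  assumes T'_group: "topological_group G T'"
    and coarser: "openin T' U \<Longrightarrow> openin T U"
begin

lemma topspace_T': "topspace T' = carrier G"
  using T'_group by (simp add: topological_group_def)

lemma limitin_T': "limitin T f A \<F> \<Longrightarrow> limitin T' f A \<F>"
  using coarser by (auto simp: limitin_def topspace_T topspace_T')

lemma limitin_T'_unique:
  "limitin T' f A \<F> \<Longrightarrow> limitin T' f B \<F> \<Longrightarrow> \<F> \<noteq> bot \<Longrightarrow> A = B"
  using T'_group limitin_Hausdorff_unique[of T' f A \<F> B] by (auto simp: topological_group_def)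

lemma limitin_T'_carrier: "limitin T' f A \<F> \<Longrightarrow> \<forall>\<^sub>F x in \<F>. f x \<in> carrier G"
  by (metis limitin_def openin_topspace topspace_T')

lemma one_in_T': "\<one>\<^bsub>G\<^esub> \<in> carrier G" by simp

lemma limitin_T'_const: "A \<in> carrier G \<Longrightarrow> limitin T' (\<lambda>_. A) A \<F>"
  by (simp add: topspace_T')

lemmas limitin_T'_mult = topological_group_limitin_mult[OF T'_group]
lemmas limitin_T'_inv = topological_group_limitin_inv[OF T'_group]

lemma limitin_T'_conj:
  assumes "limitin T' f A \<F>" "limitin T' g \<one>\<^bsub>G\<^esub> \<F>"
  shows "limitin T' (\<lambda>x. f x \<otimes>\<^bsub>G\<^esub> g x \<otimes>\<^bsub>G\<^esub> inv\<^bsub>G\<^esub> (f x)) \<one>\<^bsub>G\<^esub> \<F>"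
proof -
  have "A \<in> carrier G" using limitin_topspace[OF assms(1)] topspace_T' by simp
  moreover have "limitin T' (\<lambda>x. f x \<otimes>\<^bsub>G\<^esub> g x \<otimes>\<^bsub>G\<^esub> inv\<^bsub>G\<^esub> (f x))
      (A \<otimes>\<^bsub>G\<^esub> \<one>\<^bsub>G\<^esub> \<otimes>\<^bsub>G\<^esub> inv\<^bsub>G\<^esub> A) \<F>"
    using assms by (intro limitin_T'_mult limitin_T'_inv)
  ultimately show ?thesis by simp
qed

lemma limitin_T'_eventually_eq:
  "limitin T' f A \<F> \<Longrightarrow> (\<forall>\<^sub>F x in \<F>. f x = g x) \<Longrightarrow> limitin T' g A \<F>"
  by (rule limitin_transform_eventually)

text \<open>Suppose the root elements with parameter \<open>t\<close> tended to the identity while \<open>t\<close> tends to infinity.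
  Conjugation with \<open>torus j a\<close> replaces \<open>t\<close> by \<open>a\<^sup>2 * t\<close>, and it keeps the limit if \<open>a\<close>
  tends to 1, since then \<open>torus j a\<close> tends to the identity in the original topology and hence
  in the coarser one. With \<open>a = 1 + 1 / (4 * t)\<close> and \<open>b = 1 - 1 / (4 * t)\<close> one has
  \<open>a\<^sup>2 * t - b\<^sup>2 * t = 1\<close>, so the fixed root element with parameter 1 would be a limit of
  elements tending to the identity, against the Hausdorff property.\<close>

lemma root_element_not_at_infinity:
  assumes j: "0 < j" "j < n"
    and lim: "limitin T' (\<lambda>x. root_element j (t x)) \<one>\<^bsub>G\<^esub> \<F>"
    and tF: "\<forall>\<^sub>F x in \<F>. t x \<in> F"
    and inf: "filterlim t at_infinity \<F>"
  shows "\<F> = bot"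
proof (rule ccontr)
  assume nontriv: "\<F> \<noteq> bot"
  have u: "((\<lambda>x. inverse (t x)) \<longlongrightarrow> 0) \<F>"
    by (rule filterlim_compose[OF tendsto_inverse_0 inf])
  have torus_lim: "limitin T' (\<lambda>x. torus j (a x)) \<one>\<^bsub>G\<^esub> \<F>"
    if a: "(a \<longlongrightarrow> 1) \<F>" "\<forall>\<^sub>F x in \<F>. a x \<in> F" for a
  proof (rule limitin_T')
    have ne: "\<forall>\<^sub>F x in \<F>. a x \<noteq> 0"
      using tendsto_imp_eventually_ne[OF a(1), of 0] by simp
    have "\<forall>\<^sub>F x in \<F>. torus j (a x) \<in> carrier G"
      using a(2) ne by eventually_elim (use j in \<open>auto intro: torus_mem\<close>)
    moreover have "((\<lambda>x. torus j (a x) $$ (i, k)) \<longlongrightarrow> 1\<^sub>m n $$ (i, k)) \<F>"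
      if "i < n" "k < n" for i k
      using that j a(1) tendsto_inverse[OF a(1)]
      by (cases "k = 0"; cases "k = j") (auto simp: torus_def diagonal_entry)
    ultimately show "limitin T (\<lambda>x. torus j (a x)) \<one>\<^bsub>G\<^esub> \<F>"
      using one_in_T' by (auto simp: limitin_T_iff one_G)
  qed
  \<comment> \<open>A difference of two squares is used because the squares of \<open>F\<close> near 1 alone need not
    contain \<open>1 + 1 / t x\<close>.\<close>
  define a b where "a x = 1 + inverse (t x) / 4" and "b x = 1 - inverse (t x) / 4" for x
  have ab: "(a \<longlongrightarrow> 1) \<F>" "(b \<longlongrightarrow> 1) \<F>"
    unfolding a_def b_def by (rule tendsto_eq_intros u refl | simp)+
  have abF: "\<forall>\<^sub>F x in \<F>. a x \<in> F" "\<forall>\<^sub>F x in \<F>. b x \<in> F"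
    using tF by (auto elim!: eventually_mono simp: a_def b_def field_mem)
  have ne: "\<forall>\<^sub>F x in \<F>. a x \<noteq> 0" "\<forall>\<^sub>F x in \<F>. b x \<noteq> 0" "\<forall>\<^sub>F x in \<F>. t x \<noteq> 0"
    using tendsto_imp_eventually_ne[OF ab(1), of 0] tendsto_imp_eventually_ne[OF ab(2), of 0]
      filterlim_at_infinity_imp_eventually_ne[OF inf] by simp_all
  have "limitin T' (\<lambda>x. (torus j (a x) \<otimes>\<^bsub>G\<^esub> root_element j (t x) \<otimes>\<^bsub>G\<^esub> inv\<^bsub>G\<^esub> (torus j (a x))) \<otimes>\<^bsub>G\<^esub>
      inv\<^bsub>G\<^esub> (torus j (b x) \<otimes>\<^bsub>G\<^esub> root_element j (t x) \<otimes>\<^bsub>G\<^esub> inv\<^bsub>G\<^esub> (torus j (b x))))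
      (\<one>\<^bsub>G\<^esub> \<otimes>\<^bsub>G\<^esub> inv\<^bsub>G\<^esub> \<one>\<^bsub>G\<^esub>) \<F>"
    by (intro limitin_T'_mult limitin_T'_inv limitin_T'_conj[OF torus_lim lim] ab abF)
  moreover have "\<forall>\<^sub>F x in \<F>. (torus j (a x) \<otimes>\<^bsub>G\<^esub> root_element j (t x) \<otimes>\<^bsub>G\<^esub> inv\<^bsub>G\<^esub> (torus j (a x))) \<otimes>\<^bsub>G\<^esub>
      inv\<^bsub>G\<^esub> (torus j (b x) \<otimes>\<^bsub>G\<^esub> root_element j (t x) \<otimes>\<^bsub>G\<^esub> inv\<^bsub>G\<^esub> (torus j (b x))) = root_element j 1"
    using ne tF abF
  proof eventually_elim
    case (elim x)
    have diff: "(a x)\<^sup>2 * t x - (b x)\<^sup>2 * t x = 1"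
    proof -
      have "(a x)\<^sup>2 * t x - (b x)\<^sup>2 * t x = (a x - b x) * (a x + b x) * t x"
        by (simp only: power2_eq_square ring_distribs ac_simps) simp
      moreover have "a x - b x = inverse (t x) / 2" "a x + b x = 2" by (simp_all add: a_def b_def)
      ultimately show ?thesis using elim(3) by simp
    qed
    have mem: "(b x)\<^sup>2 * t x \<in> F" using elim by (intro mult_mem power_mem)
    have "root_element j ((a x)\<^sup>2 * t x) \<otimes>\<^bsub>G\<^esub> inv\<^bsub>G\<^esub> (root_element j ((b x)\<^sup>2 * t x)) =
        root_element j ((a x)\<^sup>2 * t x - (b x)\<^sup>2 * t x)"
      using mem by (subst row_shear_inv) (auto simp: zero_mem mult_G row_shear_mult intro!: row_shear_cong)
    then show ?case
      unfolding diff using torus_conj_root_element[OF j] elim by simp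
  qed
  ultimately have "limitin T' (\<lambda>_. root_element j 1) (\<one>\<^bsub>G\<^esub> \<otimes>\<^bsub>G\<^esub> inv\<^bsub>G\<^esub> \<one>\<^bsub>G\<^esub>) \<F>"
    by (rule limitin_T'_eventually_eq)
  then have "limitin T' (\<lambda>_. root_element j 1) \<one>\<^bsub>G\<^esub> \<F>" by simp
  moreover have "root_element j 1 \<in> carrier G" by (auto intro!: row_shear_mem simp: field_mem)
  ultimately have "root_element j 1 = \<one>\<^bsub>G\<^esub>"
    using limitin_T'_unique[OF limitin_T'_const] nontriv by blast
  then have "root_element j 1 $$ (0, j) = 1\<^sub>m n $$ (0, j)" by (simp add: one_G)
  with j show False by (simp add: row_shear_entry)
qed

text \<open>On each root subgroup the coarser topology therefore still has a bounded neighbourhood of 0.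
  Conjugation with a fixed \<open>torus j c\<close> is a homeomorphism that multiplies parameters by \<open>c\<^sup>2\<close>,
  so with a large integer \<open>c\<close> the bounded neighbourhood becomes as small as desired.\<close>

lemma root_element_tendsto_0:
  assumes j: "0 < j" "j < n"
    and lim: "limitin T' (\<lambda>x. root_element j (t x)) \<one>\<^bsub>G\<^esub> \<F>"
    and tF: "\<forall>\<^sub>F x in \<F>. t x \<in> F"
  shows "(t \<longlongrightarrow> 0) \<F>"
proof -
  \<comment> \<open>The trace on \<open>F\<close> of the neighbourhood filter of the identity; the root elements
    with parameter \<open>s\<close> tend to the identity exactly when \<open>s\<close> tends to \<open>M\<close>.\<close>
  define M where "M = inf (filtercomap (root_element j) (nhdsin T' \<one>\<^bsub>G\<^esub>)) (principal F)"
  have to_M: "filterlim s M \<G>"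
    if "limitin T' (\<lambda>x. root_element j (s x)) \<one>\<^bsub>G\<^esub> \<G>" "\<forall>\<^sub>F x in \<G>. s x \<in> F"
    for s :: "'x \<Rightarrow> complex" and \<G>
  proof -
    have "filterlim (\<lambda>x. root_element j (s x)) (nhdsin T' \<one>\<^bsub>G\<^esub>) \<G>"
      unfolding filterlim_iff
    proof (intro allI impI)
      fix P assume "eventually P (nhdsin T' \<one>\<^bsub>G\<^esub>)"
      then obtain S where S: "openin T' S" "\<one>\<^bsub>G\<^esub> \<in> S" "\<forall>A\<in>S. P A"
        using one_in_T' by (auto simp: eventually_nhdsin topspace_T')
      from limitinD[OF that(1) S(1,2)] show "\<forall>\<^sub>F x in \<G>. P (root_element j (s x))"
        by eventually_elim (use S(3) in blast)
    qed
    with that(2) show ?thesis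
      by (simp add: M_def filterlim_inf filterlim_filtercomap_iff filterlim_principal o_def)
  qed
  have "limitin T' (root_element j) \<one>\<^bsub>G\<^esub> (inf M at_infinity)"
    unfolding limitin_def
  proof (intro conjI allI impI)
    fix U assume "openin T' U \<and> \<one>\<^bsub>G\<^esub> \<in> U"
    then have "\<forall>\<^sub>F A in nhdsin T' \<one>\<^bsub>G\<^esub>. A \<in> U" by (auto simp: eventually_nhdsin)
    then have "\<forall>\<^sub>F s in filtercomap (root_element j) (nhdsin T' \<one>\<^bsub>G\<^esub>). root_element j s \<in> U"
      by (rule eventually_filtercomapI)
    then show "\<forall>\<^sub>F s in inf M at_infinity. root_element j s \<in> U"
      unfolding M_def by (rule filter_leD[rotated]) (simp add: le_infI1)
  qed (simp add: topspace_T')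
  moreover have "\<forall>\<^sub>F s in inf M at_infinity. s \<in> F"
    unfolding M_def by (rule filter_leD[of _ "principal F"]) (simp_all add: le_infI1 eventually_principal)
  moreover have "filterlim (\<lambda>s. s) at_infinity (inf M at_infinity)"
    by (simp add: filterlim_def)
  ultimately have "inf M at_infinity = bot"
    by (rule root_element_not_at_infinity[OF j])
  then have "eventually (\<lambda>_. False) (inf M at_infinity)" by simp
  then obtain P Q where PQ: "eventually P M" "eventually Q at_infinity" "\<And>s. P s \<Longrightarrow> Q s \<Longrightarrow> False"
    unfolding eventually_inf by blast
  then obtain K where K: "\<And>s. K \<le> norm s \<Longrightarrow> Q s" by (auto simp: eventually_at_infinity)
  have bounded: "\<forall>\<^sub>F s in M. norm s < K"
    using PQ(1) by eventually_elim (use PQ(3) K in \<open>meson not_less\<close>)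
  show ?thesis
  proof (rule tendstoI)
    fix \<epsilon> :: real assume \<epsilon>: "0 < \<epsilon>"
    obtain c :: nat where c: "K / \<epsilon> < real c" using reals_Archimedean2 by blast
    define c' where "c' = (of_nat (Suc c) :: complex)"
    have c': "c' \<in> F" "c' \<noteq> 0" unfolding c'_def of_nat_eq_0_iff by (simp_all only: field_mem)
    have "limitin T' (\<lambda>x. torus j c' \<otimes>\<^bsub>G\<^esub> root_element j (t x) \<otimes>\<^bsub>G\<^esub> inv\<^bsub>G\<^esub> (torus j c')) \<one>\<^bsub>G\<^esub> \<F>"
      by (rule limitin_T'_conj[OF limitin_T'_const lim]) (rule torus_mem[OF j c'])
    moreover have "\<forall>\<^sub>F x in \<F>. torus j c' \<otimes>\<^bsub>G\<^esub> root_element j (t x) \<otimes>\<^bsub>G\<^esub> inv\<^bsub>G\<^esub> (torus j c') =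
        root_element j (c'\<^sup>2 * t x)"
      using tF by eventually_elim (rule torus_conj_root_element[OF j c'])
    ultimately have "limitin T' (\<lambda>x. root_element j (c'\<^sup>2 * t x)) \<one>\<^bsub>G\<^esub> \<F>"
      by (rule limitin_T'_eventually_eq)
    moreover have "\<forall>\<^sub>F x in \<F>. c'\<^sup>2 * t x \<in> F"
      using tF by eventually_elim (simp add: field_mem c')
    ultimately have "filterlim (\<lambda>x. c'\<^sup>2 * t x) M \<F>"
      by (rule to_M)
    then have "\<forall>\<^sub>F x in \<F>. norm (c'\<^sup>2 * t x) < K"
      using bounded by (auto simp: filterlim_iff)
    then show "\<forall>\<^sub>F x in \<F>. dist (t x) 0 < \<epsilon>"
    proof eventually_elim
      case (elim x)
      have n: "norm c' = real (Suc c)" unfolding c'_def by (rule norm_of_nat)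
      have "real (Suc c) * norm (t x) \<le> (real (Suc c))\<^sup>2 * norm (t x)"
        by (intro mult_right_mono) (auto simp: power2_eq_square)
      also have "\<dots> < K" using elim by (simp only: norm_mult norm_power n)
      also have "K < real (Suc c) * \<epsilon>" using c \<epsilon> by (simp add: field_simps)
      finally show ?case by simp
    qed
  qed
qed

text \<open>The coordinates of a shear are separated by a commutator with a diagonal matrix whose entries
  all agree except the one at \<open>j\<close>: it acts trivially on every coordinate other than \<open>j\<close>, so
  the commutator is a root element in column \<open>j\<close>.\<close>

lemma row_shear_tendsto_0:
  assumes lim: "limitin T' (\<lambda>x. row_shear (v x)) \<one>\<^bsub>G\<^esub> \<F>"
    and vF: "\<forall>\<^sub>F x in \<F>. \<forall>j. 0 < j \<longrightarrow> j < n \<longrightarrow> v x j \<in> F"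
    and j: "0 < j" "j < n"
  shows "((\<lambda>x. v x j) \<longlongrightarrow> 0) \<F>"
proof -
  \<comment> \<open>The value 2 elsewhere forces \<open>inverse (2 ^ (n - 1))\<close> at \<open>j\<close>; coordinate \<open>j\<close> is then
    scaled by \<open>2 ^ n\<close>, which differs from 1.\<close>
  define f where "f i = (if i = j then inverse (2 ^ (n - 1)) else 2 :: complex)" for i
  have f: "diagonal f \<in> carrier G"
    using j unfolding f_def by (intro diagonal_mem) (auto simp: prod_update_one field_mem)
  have "2 / inverse (2 ^ (n - 1)) = (2 ^ Suc (n - 1) :: complex)"
    by (simp only: divide_inverse inverse_inverse_eq power_Suc)
  then have f0: "f 0 / f i = (if i = j then 2 ^ n else 1)" if "0 < i" for i
    using j that n_pos by (simp add: f_def del: power_Suc)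
  have f0': "f 0 * y / f i = (if i = j then 2 ^ n else 1) * y" if "0 < i" for i y
    unfolding f0[OF that, symmetric] by (simp only: times_divide_eq_left)
  have "limitin T' (\<lambda>x. diagonal f \<otimes>\<^bsub>G\<^esub> row_shear (v x) \<otimes>\<^bsub>G\<^esub> inv\<^bsub>G\<^esub> (diagonal f) \<otimes>\<^bsub>G\<^esub>
      inv\<^bsub>G\<^esub> (row_shear (v x))) (\<one>\<^bsub>G\<^esub> \<otimes>\<^bsub>G\<^esub> inv\<^bsub>G\<^esub> \<one>\<^bsub>G\<^esub>) \<F>"
    by (intro limitin_T'_mult limitin_T'_inv limitin_T'_conj[OF limitin_T'_const lim] lim f)
  moreover have "\<forall>\<^sub>F x in \<F>. diagonal f \<otimes>\<^bsub>G\<^esub> row_shear (v x) \<otimes>\<^bsub>G\<^esub> inv\<^bsub>G\<^esub> (diagonal f) \<otimes>\<^bsub>G\<^esub>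
      inv\<^bsub>G\<^esub> (row_shear (v x)) = root_element j ((2 ^ n - 1) * v x j)"
    using vF
  proof eventually_elim
    case (elim x)
    then show ?case
      using diagonal_conj_row_shear[OF f, of "v x"] row_shear_inv[of "v x"]
      by (auto intro!: row_shear_cong simp: mult_G row_shear_mult f0' left_diff_distrib)
  qed
  ultimately have "limitin T' (\<lambda>x. root_element j ((2 ^ n - 1) * v x j)) (\<one>\<^bsub>G\<^esub> \<otimes>\<^bsub>G\<^esub> inv\<^bsub>G\<^esub> \<one>\<^bsub>G\<^esub>) \<F>"
    by (rule limitin_T'_eventually_eq)
  then have "limitin T' (\<lambda>x. root_element j ((2 ^ n - 1) * v x j)) \<one>\<^bsub>G\<^esub> \<F>" by simp
  moreover have "\<forall>\<^sub>F x in \<F>. (2 ^ n - 1) * v x j \<in> F"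
    using vF by eventually_elim (use j in \<open>auto simp: field_mem\<close>)
  ultimately have "((\<lambda>x. (2 ^ n - 1) * v x j) \<longlongrightarrow> 0) \<F>"
    by (rule root_element_tendsto_0[OF j])
  then have "((\<lambda>x. (2 ^ n - 1) * v x j / (2 ^ n - 1)) \<longlongrightarrow> 0 / (2 ^ n - 1)) \<F>"
    by (rule tendsto_divide[OF _ tendsto_const]) (simp add: two_power_ne_one)
  moreover have "(2 ^ n - 1 :: complex) \<noteq> 0"
    by (simp add: two_power_ne_one)
  ultimately show ?thesis by simp
qed

text \<open>Convergence to the identity in a coarser Hausdorff group topology controls a matrix up to a
  scalar. For a row \<open>i > 0\<close>, the commutator of the matrix with the root element in column \<open>i\<close> is
  a shear whose coordinates are the entries of row \<open>i\<close> divided by the corner entry, minus the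
  identity. For the first row, the diagonal matrix that is scalar on the remaining coordinates
  commutes with everything but the first row, and its commutator with the matrix is a shear whose
  coordinates are a fixed multiple of the first row divided by the corner entry. In both cases
  \<open>row_shear_tendsto_0\<close> applies.\<close>

lemma ratio_tendsto:
  assumes lim: "limitin T' f \<one>\<^bsub>G\<^esub> \<F>" and ik: "i < n" "k < n"
  shows "((\<lambda>x. f x $$ (i, k) / f x $$ (0, 0)) \<longlongrightarrow> 1\<^sub>m n $$ (i, k)) \<F>"
proof -
  have ev: "\<forall>\<^sub>F x in \<F>. f x \<in> carrier G" by (rule limitin_T'_carrier[OF lim])
  consider "k = 0" | "0 < k" "i = 0" | "0 < k" "0 < i" by linarith
  then show ?thesis
  proof cases
    case 1
    have "\<forall>\<^sub>F x in \<F>. 1\<^sub>m n $$ (i, k) = f x $$ (i, k) / f x $$ (0, 0)"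
      using ev
    proof eventually_elim
      case (elim x)
      then show ?case
        using carrier_G_diag[OF elim, of 0] carrier_G_lower[OF elim, of 0 i] 1 ik
        by (cases "i = 0") auto
    qed
    then show ?thesis by (rule Lim_transform_eventually[OF tendsto_const])
  next
    case 2
    define d where "d i = (if i = 0 then inverse (2 ^ (n - 1)) else 2 :: complex)" for i :: nat
    define w where "w A l = (inverse (2 ^ n) - 1) * (A $$ (0, l) / A $$ (0, 0))" for A :: "complex mat" and l
    have d: "diagonal d \<in> carrier G"
      using n_pos unfolding d_def by (intro diagonal_mem) (auto simp: prod_update_one field_mem)
    have wF: "w A l \<in> F" if "A \<in> carrier G" "l < n" for A l
      using that n_pos carrier_G_mem[OF that(1)] by (auto simp: w_def field_mem)
    have comm: "diagonal d \<otimes>\<^bsub>G\<^esub> A = A \<otimes>\<^bsub>G\<^esub> row_shear (w A) \<otimes>\<^bsub>G\<^esub> diagonal d" if A: "A \<in> carrier G" for A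
      unfolding mult_G
    proof (rule entries_eqI)
      fix p q assume pq: "p < n" "q < n"
      have 2: "inverse (2 ^ (n - Suc 0)) = 2 * inverse (2 ^ n :: complex)"
        using n_pos by (cases n) auto
      have "A $$ (p, q) = 0" if "0 < p" "q = 0" using carrier_G_lower[OF A, of q p] that pq by simp
      then show "(diagonal d * A) $$ (p, q) = (A * row_shear (w A) * diagonal d) $$ (p, q)"
        using pq n_pos carrier_G_diag[OF A, of 0] carrier_G_lower[OF A, of 0 p]
        by (auto simp: diagonal_mult_entry mult_diagonal_entry mult_row_shear_entry carrier_G_mat[OF A]
            mult_carrier_mat[OF carrier_G_mat[OF A]] d_def w_def algebra_simps 2)
    qed (auto intro!: mult_carrier_mat[of _ n n] carrier_G_mat[OF A])
    have "limitin T' (\<lambda>x. inv\<^bsub>G\<^esub> (f x) \<otimes>\<^bsub>G\<^esub> (diagonal d \<otimes>\<^bsub>G\<^esub> f x \<otimes>\<^bsub>G\<^esub> inv\<^bsub>G\<^esub> (diagonal d)))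
        (inv\<^bsub>G\<^esub> \<one>\<^bsub>G\<^esub> \<otimes>\<^bsub>G\<^esub> \<one>\<^bsub>G\<^esub>) \<F>"
      by (intro limitin_T'_mult limitin_T'_inv limitin_T'_conj[OF limitin_T'_const lim] lim d)
    moreover have "\<forall>\<^sub>F x in \<F>. inv\<^bsub>G\<^esub> (f x) \<otimes>\<^bsub>G\<^esub> (diagonal d \<otimes>\<^bsub>G\<^esub> f x \<otimes>\<^bsub>G\<^esub> inv\<^bsub>G\<^esub> (diagonal d)) = row_shear (w (f x))"
      using ev
    proof eventually_elim
      case (elim x)
      have "row_shear (w (f x)) \<in> carrier G" using wF[OF elim] by (intro row_shear_mem)
      with elim d show ?case by (simp add: comm grp.m_assoc inv_cancel_left)
    qed
    ultimately have "limitin T' (\<lambda>x. row_shear (w (f x))) (inv\<^bsub>G\<^esub> \<one>\<^bsub>G\<^esub> \<otimes>\<^bsub>G\<^esub> \<one>\<^bsub>G\<^esub>) \<F>"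
      by (rule limitin_T'_eventually_eq)
    then have "limitin T' (\<lambda>x. row_shear (w (f x))) \<one>\<^bsub>G\<^esub> \<F>" by simp
    then have "((\<lambda>x. w (f x) k) \<longlongrightarrow> 0) \<F>"
      by (rule row_shear_tendsto_0) (use ev 2 ik wF in \<open>auto elim!: eventually_mono\<close>)
    then have "((\<lambda>x. w (f x) k / (inverse (2 ^ n) - 1)) \<longlongrightarrow> 0 / (inverse (2 ^ n) - 1)) \<F>"
      by (rule tendsto_divide[OF _ tendsto_const]) (simp add: two_power_ne_one)
    moreover have "(inverse (2 ^ n) - 1 :: complex) \<noteq> 0"
      by (simp add: two_power_ne_one)
    ultimately show ?thesis using 2 ik by (simp add: w_def)
  next
    case 3
    define w where "w A l = A $$ (i, l) / A $$ (0, 0) - (if l = i then 1 else 0)" for A :: "complex mat" and l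
    have wF: "w A l \<in> F" if "A \<in> carrier G" "l < n" for A l
      using that n_pos ik carrier_G_mem[OF that(1)] by (auto simp: w_def field_mem)
    have e: "root_element i 1 \<in> carrier G" by (auto intro!: row_shear_mem simp: field_mem)
    have comm: "root_element i 1 \<otimes>\<^bsub>G\<^esub> A = A \<otimes>\<^bsub>G\<^esub> (row_shear (w A) \<otimes>\<^bsub>G\<^esub> root_element i 1)" if A: "A \<in> carrier G" for A
      unfolding mult_G row_shear_mult
    proof (rule entries_eqI)
      fix p q assume pq: "p < n" "q < n"
      show "(root_element i 1 * A) $$ (p, q) = (A * row_shear (\<lambda>j. w A j + (if j = i then 1 else 0))) $$ (p, q)"
        using pq n_pos ik 3 carrier_G_diag[OF A, of 0] carrier_G_lower[OF A, of 0 p] carrier_G_lower[OF A, of 0 i]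
        by (auto simp: root_element_mult_entry mult_row_shear_entry carrier_G_mat[OF A] w_def)
    qed (auto intro!: mult_carrier_mat[of _ n n] carrier_G_mat[OF A])
    have "limitin T' (\<lambda>x. inv\<^bsub>G\<^esub> (f x) \<otimes>\<^bsub>G\<^esub> (root_element i 1 \<otimes>\<^bsub>G\<^esub> f x \<otimes>\<^bsub>G\<^esub> inv\<^bsub>G\<^esub> (root_element i 1)))
        (inv\<^bsub>G\<^esub> \<one>\<^bsub>G\<^esub> \<otimes>\<^bsub>G\<^esub> \<one>\<^bsub>G\<^esub>) \<F>"
      by (intro limitin_T'_mult limitin_T'_inv limitin_T'_conj[OF limitin_T'_const lim] lim e)
    moreover have "\<forall>\<^sub>F x in \<F>. inv\<^bsub>G\<^esub> (f x) \<otimes>\<^bsub>G\<^esub> (root_element i 1 \<otimes>\<^bsub>G\<^esub> f x \<otimes>\<^bsub>G\<^esub> inv\<^bsub>G\<^esub> (root_element i 1)) = row_shear (w (f x))"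
      using ev
    proof eventually_elim
      case (elim x)
      have "row_shear (w (f x)) \<in> carrier G" using wF[OF elim] by (intro row_shear_mem)
      with elim e show ?case by (simp add: comm grp.m_assoc inv_cancel_left)
    qed
    ultimately have "limitin T' (\<lambda>x. row_shear (w (f x))) (inv\<^bsub>G\<^esub> \<one>\<^bsub>G\<^esub> \<otimes>\<^bsub>G\<^esub> \<one>\<^bsub>G\<^esub>) \<F>"
      by (rule limitin_T'_eventually_eq)
    then have "limitin T' (\<lambda>x. row_shear (w (f x))) \<one>\<^bsub>G\<^esub> \<F>" by simp
    then have "((\<lambda>x. w (f x) k) \<longlongrightarrow> 0) \<F>"
      by (rule row_shear_tendsto_0) (use ev 3 ik wF in \<open>auto elim!: eventually_mono\<close>)
    then have "((\<lambda>x. w (f x) k + (if k = i then 1 else 0)) \<longlongrightarrow> 0 + (if k = i then 1 else 0)) \<F>"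
      by (intro tendsto_add tendsto_const)
    then show ?thesis using 3 ik by (auto simp: w_def)
  qed
qed

end

section \<open>Minimality\<close>

context triangular_group
begin

lemma tendsto_power_entry:
  assumes ev: "\<forall>\<^sub>F x in \<F>. f x \<in> carrier G"
    and lim: "\<And>i j. i < n \<Longrightarrow> j < n \<Longrightarrow> ((\<lambda>x. f x $$ (i, j)) \<longlongrightarrow> (if i = j then z else 0)) \<F>"
    and "i < n" "j < n"
  shows "((\<lambda>x. (f x [^]\<^bsub>G\<^esub> (k::nat)) $$ (i, j)) \<longlongrightarrow> (if i = j then z ^ k else 0)) \<F>"
  using \<open>i < n\<close> \<open>j < n\<close>
proof (induction k arbitrary: i j)
  case 0
  then show ?case by (simp add: one_G)
next
  case (Suc k)
  have "((\<lambda>x. \<Sum>l<n. (f x [^]\<^bsub>G\<^esub> k) $$ (i, l) * f x $$ (l, j)) \<longlongrightarrow>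
      (\<Sum>l<n. (if i = l then z ^ k else 0) * (if l = j then z else 0))) \<F>"
    using Suc by (intro tendsto_sum tendsto_mult lim Suc.IH) auto
  also have "(\<Sum>l<n. (if i = l then z ^ k else 0) * (if l = j then z else 0)) =
      (\<Sum>l<n. if l = i then if i = j then z ^ Suc k else 0 else 0)"
    by (intro sum.cong) auto
  also have "\<dots> = (if i = j then z ^ Suc k else 0)" using Suc.prems by simp
  finally show ?case
  proof (rule Lim_transform_eventually)
    show "\<forall>\<^sub>F x in \<F>. (\<Sum>l<n. (f x [^]\<^bsub>G\<^esub> k) $$ (i, l) * f x $$ (l, j)) = (f x [^]\<^bsub>G\<^esub> Suc k) $$ (i, j)"
      using ev
    proof eventually_elim
      case (elim x)
      then have "f x [^]\<^bsub>G\<^esub> k \<in> carrier G" by simp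
      then show ?case
        using Suc.prems elim by (simp add: mult_G mult_entry carrier_G_mat)
    qed
  qed
qed

end

context coarser_topology
begin

text \<open>Divide the equation that the product of the diagonal entries is 1 by the \<open>n\<close>-th power of the
  corner entry: the ratios on the left tend to 1.\<close>

lemma corner_power_tendsto_1:
  assumes lim: "limitin T' f \<one>\<^bsub>G\<^esub> \<F>"
  shows "((\<lambda>x. (f x $$ (0, 0)) ^ n) \<longlongrightarrow> 1) \<F>"
proof -
  have "((\<lambda>x. \<Prod>i<n. f x $$ (i, i) / f x $$ (0, 0)) \<longlongrightarrow> (\<Prod>i<n. 1\<^sub>m n $$ (i, i))) \<F>"
    by (intro tendsto_prod ratio_tendsto lim) auto
  then have "((\<lambda>x. inverse (\<Prod>i<n. f x $$ (i, i) / f x $$ (0, 0))) \<longlongrightarrow> inverse 1) \<F>"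
    by (intro tendsto_inverse) auto
  moreover have "\<forall>\<^sub>F x in \<F>. inverse (\<Prod>i<n. f x $$ (i, i) / f x $$ (0, 0)) = (f x $$ (0, 0)) ^ n"
    using limitin_T'_carrier[OF lim]
    by eventually_elim (simp add: prod_dividef carrier_G_diag_prod)
  ultimately show ?thesis
    using Lim_transform_eventually by fastforce
qed

text \<open>Only the scalar remains to be controlled. Its \<open>n\<close>-th power tends to 1, so if the scalar does
  not tend to 1 itself, it clusters at an \<open>n\<close>-th root of unity \<open>z\<close> different from 1. On a finer
  filter the matrices then tend entrywise to \<open>z\<close> times the identity. That matrix may lie outside
  the group, but its \<open>k\<close>-th power lies inside for a suitable \<open>k\<close> and is not the identity; it is
  a limit of \<open>k\<close>-th powers of matrices tending to the identity, which contradicts the Hausdorff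
  property.\<close>

lemma limitin_T'_one_imp_limitin_T:
  assumes roots: "\<And>z. z \<in> closure F \<Longrightarrow> z ^ n = 1 \<Longrightarrow> z \<noteq> 1 \<Longrightarrow> \<exists>k::nat. z ^ k \<in> F \<and> z ^ k \<noteq> 1"
    and lim: "limitin T' f \<one>\<^bsub>G\<^esub> \<F>"
  shows "limitin T f \<one>\<^bsub>G\<^esub> \<F>"
proof -
  define c where "c x = f x $$ (0, 0)" for x
  have scaled: "((\<lambda>x. f x $$ (i, j)) \<longlongrightarrow> (if i = j then z else 0)) \<G>"
    if \<G>: "\<G> \<le> \<F>" "(c \<longlongrightarrow> z) \<G>" and ij: "i < n" "j < n" for z \<G> i j
  proof -
    have ev: "\<forall>\<^sub>F x in \<G>. f x \<in> carrier G"
      by (rule filter_leD[OF \<G>(1) limitin_T'_carrier[OF lim]])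
    have "((\<lambda>x. f x $$ (i, j) / f x $$ (0, 0)) \<longlongrightarrow> 1\<^sub>m n $$ (i, j)) \<G>"
      by (rule ratio_tendsto[OF limitin_mono[OF lim \<G>(1)] ij])
    from tendsto_mult[OF \<G>(2) this]
    have "((\<lambda>x. c x * (f x $$ (i, j) / f x $$ (0, 0))) \<longlongrightarrow> (if i = j then z else 0)) \<G>"
      using ij by (auto simp: if_distrib cong: if_cong)
    moreover have "\<forall>\<^sub>F x in \<G>. c x * (f x $$ (i, j) / f x $$ (0, 0)) = f x $$ (i, j)"
      using ev by eventually_elim (use n_pos carrier_G_diag[of _ 0] in \<open>auto simp: c_def\<close>)
    ultimately show ?thesis by (rule Lim_transform_eventually)
  qed
  have cn: "((\<lambda>x. c x ^ n) \<longlongrightarrow> 1) \<F>"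
    unfolding c_def by (rule corner_power_tendsto_1[OF lim])
  have "(c \<longlongrightarrow> 1) \<F>"
  proof (rule ccontr)
    have "\<forall>\<^sub>F x in \<F>. dist (c x ^ n) 1 < 1"
      using cn by (rule tendstoD) simp
    then have "\<forall>\<^sub>F x in \<F>. c x \<in> cball 0 2"
    proof eventually_elim
      case (elim x)
      have "norm (c x ^ n) \<le> norm (c x ^ n - 1) + 1"
        using norm_triangle_ineq[of "c x ^ n - 1" 1] by simp
      with elim have "norm (c x) ^ n < 2" by (simp add: dist_norm norm_power)
      moreover have "norm (c x) \<le> norm (c x) ^ n" if "1 \<le> norm (c x)"
        using that n_pos by (intro self_le_power) auto
      ultimately show ?case by (cases "1 \<le> norm (c x)") auto
    qed
    moreover assume "\<not> (c \<longlongrightarrow> 1) \<F>"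
    ultimately obtain z \<G> where z: "z \<noteq> 1" and \<G>: "\<G> \<le> \<F>" "\<G> \<noteq> bot" "(c \<longlongrightarrow> z) \<G>"
      by (rule not_tendsto_imp_cluster[OF compact_cball])
    have ev: "\<forall>\<^sub>F x in \<G>. f x \<in> carrier G"
      by (rule filter_leD[OF \<G>(1) limitin_T'_carrier[OF lim]])
    have "((\<lambda>x. c x ^ n) \<longlongrightarrow> 1) \<G>" by (rule tendsto_mono[OF \<G>(1) cn])
    then have "z ^ n = 1"
      using tendsto_unique[OF \<G>(2) tendsto_power[OF \<G>(3)]] by blast
    moreover have "z \<in> closure F"
    proof (rule Lim_in_closed_set[OF closed_closure _ \<G>(2,3)])
      show "\<forall>\<^sub>F x in \<G>. c x \<in> closure F"
        using ev by eventually_elim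
          (use n_pos carrier_G_mem closure_subset in \<open>fastforce simp: c_def\<close>)
    qed
    ultimately obtain k where k: "z ^ k \<in> F" "z ^ k \<noteq> 1" using roots z by blast
    have "(z ^ k) ^ n = 1"
      using \<open>z ^ n = 1\<close> by (metis mult.commute power_mult power_one)
    then have diag: "diagonal (\<lambda>_. z ^ k) \<in> carrier G"
      using k by (intro diagonal_mem) auto
    have "limitin T (\<lambda>x. f x [^]\<^bsub>G\<^esub> k) (diagonal (\<lambda>_. z ^ k)) \<G>"
      unfolding limitin_T_iff
    proof (intro conjI diag allI impI)
      show "\<forall>\<^sub>F x in \<G>. f x [^]\<^bsub>G\<^esub> k \<in> carrier G"
        using ev by eventually_elim simp
      show "((\<lambda>x. (f x [^]\<^bsub>G\<^esub> k) $$ (i, j)) \<longlongrightarrow> diagonal (\<lambda>_. z ^ k) $$ (i, j)) \<G>"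
        if "i < n" "j < n" for i j
        using tendsto_power_entry[OF ev scaled[OF \<G>(1,3)] that] that by (simp add: diagonal_entry)
    qed
    moreover have "limitin T' (\<lambda>x. f x [^]\<^bsub>G\<^esub> k) (\<one>\<^bsub>G\<^esub> [^]\<^bsub>G\<^esub> k) \<G>"
      by (rule topological_group_limitin_pow[OF T'_group limitin_mono[OF lim \<G>(1)]])
    ultimately have "diagonal (\<lambda>_. z ^ k) = \<one>\<^bsub>G\<^esub> [^]\<^bsub>G\<^esub> k"
      using limitin_T'_unique[OF limitin_T' _ \<G>(2)] by blast
    then have "diagonal (\<lambda>_. z ^ k) = \<one>\<^bsub>G\<^esub>" by simp
    then have "diagonal (\<lambda>_. z ^ k) $$ (0, 0) = 1\<^sub>m n $$ (0, 0)" by (simp add: one_G)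
    with k n_pos show False by (simp add: diagonal_entry)
  qed
  from scaled[OF order_refl this] limitin_T'_carrier[OF lim] show ?thesis
    using one_in_T' by (auto simp: limitin_T_iff one_G)
qed

end

context triangular_group
begin

theorem minimal_if_roots:
  assumes "\<And>z. z \<in> closure F \<Longrightarrow> z ^ n = 1 \<Longrightarrow> z \<noteq> 1 \<Longrightarrow> \<exists>k::nat. z ^ k \<in> F \<and> z ^ k \<noteq> 1"
  shows "minimal_topological_group G T"
  unfolding minimal_topological_group_def
proof (intro conjI T_topological_group allI impI)
  fix T' assume T': "topological_group G T' \<and> (\<forall>U. openin T' U \<longrightarrow> openin T U)"
  then interpret coarser_topology F n T' by unfold_locales auto
  show "T' = T"
    by (rule topological_group_eqI[OF T_topological_group T'_group coarser])
      (auto intro: limitin_T'_one_imp_limitin_T assms)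
qed

section \<open>A strictly coarser group topology\<close>

text \<open>The coordinates used here do not change when a matrix is multiplied by an \<open>m\<close>-th root of
  unity, and together they determine the matrix up to such a factor. For \<open>m\<close> dividing \<open>n\<close> the
  topology is thus the one inherited from the quotient of the group over the complex numbers by
  the central subgroup of \<open>m\<close>-th roots of unity.\<close>

definition ratio_topology :: "nat \<Rightarrow> complex mat topology" where
  "ratio_topology m = pullback_topology (carrier G)
     (\<lambda>A. ((A $$ (0, 0)) ^ m, \<lambda>p\<in>{..<n} \<times> {..<n}. A $$ p / A $$ (0, 0)))
     (prod_topology euclidean (product_topology (\<lambda>_. euclidean) ({..<n} \<times> {..<n})))"

lemma topspace_ratio_topology: "topspace (ratio_topology m) = carrier G"
  by (auto simp: ratio_topology_def topspace_pullback_topology)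

lemma limitin_ratio_topology_iff:
  "limitin (ratio_topology m) f A \<F> \<longleftrightarrow> A \<in> carrier G \<and> (\<forall>\<^sub>F x in \<F>. f x \<in> carrier G) \<and>
     ((\<lambda>x. (f x $$ (0, 0)) ^ m) \<longlongrightarrow> (A $$ (0, 0)) ^ m) \<F> \<and>
     (\<forall>i<n. \<forall>j<n. ((\<lambda>x. f x $$ (i, j) / f x $$ (0, 0)) \<longlongrightarrow> A $$ (i, j) / A $$ (0, 0)) \<F>)"
  unfolding ratio_topology_def limitin_pullback_topology
  by (auto simp: limitin_pairwise limitin_componentwise o_def)

lemma inv_corner:
  assumes "A \<in> carrier G"
  shows "(inv\<^bsub>G\<^esub> A) $$ (0, 0) = inverse (A $$ (0, 0))"
proof -
  have "(inv\<^bsub>G\<^esub> A) $$ (0, 0) * A $$ (0, 0) = (inv\<^bsub>G\<^esub> A * A) $$ (0, 0)"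
    using assms n_pos by (simp add: mult_diag_entry)
  also have "inv\<^bsub>G\<^esub> A * A = 1\<^sub>m n" using grp.l_inv[OF assms] by (simp add: mult_G one_G)
  finally show ?thesis
    using n_pos carrier_G_diag[OF assms, of 0] by (simp add: field_simps)
qed

text \<open>The ratios of the inverse are expressed through the ratios and the \<open>n\<close>-th power of the corner
  entry; for \<open>m\<close> dividing \<open>n\<close> the latter is a power of the \<open>m\<close>-th power.\<close>

lemma inv_ratio:
  assumes A: "A \<in> carrier G" and ij: "i < n" "j < n"
  shows "(inv\<^bsub>G\<^esub> A) $$ (i, j) / (inv\<^bsub>G\<^esub> A) $$ (0, 0) =
    (A $$ (0, 0)) ^ n * adj_mat (mat n n (\<lambda>p. A $$ p / A $$ (0, 0))) $$ (i, j)"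
proof -
  define c where "c = A $$ (0, 0)"
  have c: "c \<noteq> 0" using n_pos carrier_G_diag[OF A, of 0] by (simp add: c_def)
  have "A = c \<cdot>\<^sub>m mat n n (\<lambda>p. A $$ p / c)" (is "_ = c \<cdot>\<^sub>m ?N")
    using c carrier_G_dim[OF A] by (intro eq_matI) auto
  then have "mat_delete A j i = c \<cdot>\<^sub>m mat_delete ?N j i"
    using ij carrier_G_dim[OF A] c by (intro eq_matI) (auto simp: mat_delete_def)
  then have "cofactor A j i = c ^ (n - 1) * cofactor ?N j i"
    by (simp add: cofactor_def)
  then have "adj_mat A $$ (i, j) = c ^ (n - 1) * adj_mat ?N $$ (i, j)"
    using ij carrier_G_dim[OF A] by (simp add: adj_mat_def)
  moreover have "c * c ^ (n - 1) = c ^ n" using n_pos by (cases n) auto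
  ultimately show ?thesis
    by (simp add: inv_corner A inv_G[symmetric] c_def[symmetric] divide_inverse mult_ac)
qed

text \<open>Without nontrivial \<open>m\<close>-th roots of unity in \<open>F\<close> the coordinates separate the matrices over
  \<open>F\<close>, which makes the topology Hausdorff.\<close>

lemma ratio_topology_group:
  assumes m: "m > 1" "m dvd n" and roots: "\<And>z. z \<in> F \<Longrightarrow> z ^ m = 1 \<Longrightarrow> z = 1"
  shows "topological_group G (ratio_topology m)"
proof (rule topological_groupI_limits[OF group_G topspace_ratio_topology])
  have "inj_on (\<lambda>A. ((A $$ (0, 0)) ^ m, \<lambda>p\<in>{..<n} \<times> {..<n}. A $$ p / A $$ (0, 0))) (carrier G)"
  proof (rule inj_onI)
    fix A B :: "complex mat" assume A: "A \<in> carrier G" and B: "B \<in> carrier G"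
      and eq: "((A $$ (0, 0)) ^ m, \<lambda>p\<in>{..<n} \<times> {..<n}. A $$ p / A $$ (0, 0)) =
        ((B $$ (0, 0)) ^ m, \<lambda>p\<in>{..<n} \<times> {..<n}. B $$ p / B $$ (0, 0))"
    have ne: "A $$ (0, 0) \<noteq> 0" "B $$ (0, 0) \<noteq> 0" using n_pos carrier_G_diag[OF A, of 0] carrier_G_diag[OF B, of 0] by auto
    have "(A $$ (0, 0) / B $$ (0, 0)) ^ m = 1"
      using eq ne by (simp add: power_divide)
    moreover have "A $$ (0, 0) / B $$ (0, 0) \<in> F"
      using A B n_pos by (intro divide_mem) (auto intro: carrier_G_mem)
    ultimately have "A $$ (0, 0) / B $$ (0, 0) = 1" by (rule roots[rotated])
    then have corner: "A $$ (0, 0) = B $$ (0, 0)" using ne by simp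
    have "A $$ (i, j) = B $$ (i, j)" if "i < n" "j < n" for i j
    proof -
      have "(\<lambda>p\<in>{..<n} \<times> {..<n}. A $$ p / A $$ (0, 0)) = (\<lambda>p\<in>{..<n} \<times> {..<n}. B $$ p / B $$ (0, 0))"
        using eq by simp
      from fun_cong[OF this, of "(i, j)"] that
      have "A $$ (i, j) / A $$ (0, 0) = B $$ (i, j) / B $$ (0, 0)" by simp
      with corner ne show ?thesis by simp
    qed
    with A B show "A = B" by (intro entries_eqI carrier_G_mat)
  qed
  then show "Hausdorff_space (ratio_topology m)"
    unfolding ratio_topology_def
    by (intro Hausdorff_space_pullback_topology)
      (simp_all add: Hausdorff_space_product_topology Hausdorff_space_prod_topology)
next
  fix \<F> :: "(complex mat \<times> complex mat) filter" and A B
  assume lim: "limitin (ratio_topology m) fst A \<F>" "limitin (ratio_topology m) snd B \<F>"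
  then have ev: "\<forall>\<^sub>F p in \<F>. fst p \<in> carrier G \<and> snd p \<in> carrier G"
    and A: "A \<in> carrier G" and B: "B \<in> carrier G"
    by (auto simp: limitin_ratio_topology_iff intro: eventually_conj)
  have corner: "((C * D) $$ (0, 0)) ^ m = (C $$ (0, 0)) ^ m * (D $$ (0, 0)) ^ m"
    if "C \<in> carrier G" "D \<in> carrier G" for C D
    using that n_pos by (simp add: mult_diag_entry power_mult_distrib)
  have ratio: "(C * D) $$ (i, j) / (C * D) $$ (0, 0) =
      (\<Sum>k<n. C $$ (i, k) / C $$ (0, 0) * (D $$ (k, j) / D $$ (0, 0)))"
    if "C \<in> carrier G" "D \<in> carrier G" "i < n" "j < n" for C D i j
    using that n_pos mult_entry[OF carrier_G_mat carrier_G_mat, OF that]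
    by (simp add: mult_diag_entry sum_divide_distrib)
  have "((\<lambda>p. ((fst p * snd p) $$ (0, 0)) ^ m) \<longlongrightarrow> ((A * B) $$ (0, 0)) ^ m) \<F>"
  proof (rule Lim_transform_eventually)
    show "((\<lambda>p. (fst p $$ (0, 0)) ^ m * (snd p $$ (0, 0)) ^ m) \<longlongrightarrow> ((A * B) $$ (0, 0)) ^ m) \<F>"
      unfolding corner[OF A B] using lim by (intro tendsto_mult) (auto simp: limitin_ratio_topology_iff)
    show "\<forall>\<^sub>F p in \<F>. (fst p $$ (0, 0)) ^ m * (snd p $$ (0, 0)) ^ m = ((fst p * snd p) $$ (0, 0)) ^ m"
      using ev by eventually_elim (simp add: corner)
  qed
  moreover have "((\<lambda>p. (fst p * snd p) $$ (i, j) / (fst p * snd p) $$ (0, 0)) \<longlongrightarrow>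
      (A * B) $$ (i, j) / (A * B) $$ (0, 0)) \<F>" if ij: "i < n" "j < n" for i j
  proof (rule Lim_transform_eventually)
    show "((\<lambda>p. \<Sum>k<n. fst p $$ (i, k) / fst p $$ (0, 0) * (snd p $$ (k, j) / snd p $$ (0, 0))) \<longlongrightarrow>
        (A * B) $$ (i, j) / (A * B) $$ (0, 0)) \<F>"
      unfolding ratio[OF A B ij] using lim ij
      by (intro tendsto_sum tendsto_mult) (auto simp: limitin_ratio_topology_iff)
    show "\<forall>\<^sub>F p in \<F>. (\<Sum>k<n. fst p $$ (i, k) / fst p $$ (0, 0) * (snd p $$ (k, j) / snd p $$ (0, 0))) =
        (fst p * snd p) $$ (i, j) / (fst p * snd p) $$ (0, 0)"
      using ev by eventually_elim (simp only: ratio ij)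
  qed
  moreover have "\<forall>\<^sub>F p in \<F>. fst p * snd p \<in> carrier G"
    using ev by eventually_elim (auto intro: mult_closed)
  ultimately show "limitin (ratio_topology m) (\<lambda>p. fst p \<otimes>\<^bsub>G\<^esub> snd p) (A \<otimes>\<^bsub>G\<^esub> B) \<F>"
    using A B by (simp add: limitin_ratio_topology_iff mult_G mult_closed)
next
  fix \<F> :: "complex mat filter" and A
  assume lim: "limitin (ratio_topology m) (\<lambda>x. x) A \<F>"
  then have ev: "\<forall>\<^sub>F x in \<F>. x \<in> carrier G" and A: "A \<in> carrier G"
    and lim_corner: "((\<lambda>x. (x $$ (0, 0)) ^ m) \<longlongrightarrow> (A $$ (0, 0)) ^ m) \<F>"
    by (auto simp: limitin_ratio_topology_iff)
  obtain q where q: "n = m * q" using m by blast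
  have "((\<lambda>x. ((inv\<^bsub>G\<^esub> x) $$ (0, 0)) ^ m) \<longlongrightarrow> ((inv\<^bsub>G\<^esub> A) $$ (0, 0)) ^ m) \<F>"
  proof (rule Lim_transform_eventually)
    show "((\<lambda>x. inverse ((x $$ (0, 0)) ^ m)) \<longlongrightarrow> ((inv\<^bsub>G\<^esub> A) $$ (0, 0)) ^ m) \<F>"
      unfolding inv_corner[OF A] power_inverse
      using n_pos carrier_G_diag[OF A, of 0] by (intro tendsto_inverse lim_corner) auto
    show "\<forall>\<^sub>F x in \<F>. inverse ((x $$ (0, 0)) ^ m) = ((inv\<^bsub>G\<^esub> x) $$ (0, 0)) ^ m"
      using ev by eventually_elim (simp add: inv_corner power_inverse)
  qed
  moreover have "((\<lambda>x. (inv\<^bsub>G\<^esub> x) $$ (i, j) / (inv\<^bsub>G\<^esub> x) $$ (0, 0)) \<longlongrightarrow>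
      (inv\<^bsub>G\<^esub> A) $$ (i, j) / (inv\<^bsub>G\<^esub> A) $$ (0, 0)) \<F>" if ij: "i < n" "j < n" for i j
  proof (rule Lim_transform_eventually)
    show "((\<lambda>x. ((x $$ (0, 0)) ^ m) ^ q * adj_mat (mat n n (\<lambda>p. x $$ p / x $$ (0, 0))) $$ (i, j)) \<longlongrightarrow>
        (inv\<^bsub>G\<^esub> A) $$ (i, j) / (inv\<^bsub>G\<^esub> A) $$ (0, 0)) \<F>"
      unfolding inv_ratio[OF A ij]
      unfolding q power_mult
      unfolding q[symmetric]
    proof (intro tendsto_mult tendsto_power[OF lim_corner] tendsto_adj_mat[OF _ _ _ ij])
      fix k l assume "k < n" "l < n"
      then show "((\<lambda>x. mat n n (\<lambda>p. x $$ p / x $$ (0, 0)) $$ (k, l)) \<longlongrightarrow>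
          mat n n (\<lambda>p. A $$ p / A $$ (0, 0)) $$ (k, l)) \<F>"
        using lim by (simp add: limitin_ratio_topology_iff)
    qed auto
    show "\<forall>\<^sub>F x in \<F>. ((x $$ (0, 0)) ^ m) ^ q * adj_mat (mat n n (\<lambda>p. x $$ p / x $$ (0, 0))) $$ (i, j) =
        (inv\<^bsub>G\<^esub> x) $$ (i, j) / (inv\<^bsub>G\<^esub> x) $$ (0, 0)"
      using ev by eventually_elim (simp only: inv_ratio ij power_mult[symmetric] q[symmetric])
  qed
  moreover have "\<forall>\<^sub>F x in \<F>. inv\<^bsub>G\<^esub> x \<in> carrier G"
    using ev by eventually_elim auto
  ultimately show "limitin (ratio_topology m) (\<lambda>x. inv\<^bsub>G\<^esub> x) (inv\<^bsub>G\<^esub> A) \<F>"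
    using A by (simp add: limitin_ratio_topology_iff)
qed

lemma ratio_topology_coarser:
  assumes "openin (ratio_topology m) U"
  shows "openin T U"
proof -
  have "continuous_map T (ratio_topology m) (\<lambda>x. x)"
    unfolding continuous_map_atin
  proof
    fix A assume "A \<in> topspace T"
    then have "limitin T (\<lambda>x. x) A (atin T A)" by (intro limitin_continuous_map) auto
    moreover from this have "A $$ (0, 0) \<noteq> 0"
      using n_pos carrier_G_diag[of A 0] by (auto simp: limitin_T_iff)
    ultimately show "limitin (ratio_topology m) (\<lambda>x. x) A (atin T A)"
      using n_pos by (auto simp: limitin_T_iff limitin_ratio_topology_iff intro!: tendsto_power tendsto_divide)
  qed
  then have "openin T {x \<in> topspace T. x \<in> U}"
    using assms by (auto simp: continuous_map_def)
  moreover have "{x \<in> topspace T. x \<in> U} = U"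
    using openin_subset[OF assms] by (auto simp: topspace_T topspace_ratio_topology)
  ultimately show ?thesis by simp
qed

text \<open>By density a nontrivial \<open>m\<close>-th root of unity \<open>r\<close> is a limit of elements \<open>a k\<close> of \<open>F\<close>.
  Diagonal matrices with entries \<open>a k\<close>, except for the last one, which is fixed by the
  determinant, tend to \<open>r\<close> times the identity over the complex numbers, because \<open>r ^ n = 1\<close>.
  The ratio topology does not see the factor \<open>r\<close>, so there they tend to the identity.\<close>

theorem not_minimal_if_no_roots:
  assumes dense: "closure F = UNIV"
    and m: "m > 1" "m dvd n" and roots: "\<And>z. z \<in> F \<Longrightarrow> z ^ m = 1 \<Longrightarrow> z = 1"
  shows "\<not> minimal_topological_group G T"
proof
  assume "minimal_topological_group G T"
  then have eq: "ratio_topology m = T"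
    using ratio_topology_group[OF m roots] ratio_topology_coarser
    by (auto simp: minimal_topological_group_def)
  obtain r :: complex where r: "r ^ m = 1" "r \<noteq> 1"
  proof -
    have "card {z :: complex. z ^ m = 1} = m" using m by (intro card_roots_unity_eq) auto
    with m have "\<not> {z :: complex. z ^ m = 1} \<subseteq> {1}"
      using card_mono[of "{1 :: complex}" "{z. z ^ m = 1}"] by auto
    with that show ?thesis by auto
  qed
  have rn: "r ^ n = 1" using r(1) m(2) by (metis dvd_def power_mult power_one)
  have n2: "n \<ge> 2" using m n_pos by (auto dest: dvd_imp_le)
  have "r \<in> closure F" using dense by simp
  then obtain a where a: "\<And>k. a k \<in> F" "a \<longlonglongrightarrow> r"
    unfolding closure_sequential by blast
  have "r \<noteq> 0" using r m by (auto simp: power_0_left)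
  then have ne: "\<forall>\<^sub>F k in sequentially. a k \<noteq> 0" by (rule tendsto_imp_eventually_ne[OF a(2)])
  define B where "B k = diagonal (\<lambda>i. if i = n - 1 then inverse (a k ^ (n - 1)) else a k)" for k
  have evB: "\<forall>\<^sub>F k in sequentially. B k \<in> carrier G"
    using ne unfolding B_def
    by eventually_elim (use a(1) n_pos in \<open>auto intro!: diagonal_mem simp: prod_update_one field_mem\<close>)
  have B00: "B k $$ (0, 0) = a k" for k using n2 by (simp add: B_def diagonal_entry)
  have "((\<lambda>k. B k $$ (i, j) / B k $$ (0, 0)) \<longlonglongrightarrow> \<one>\<^bsub>G\<^esub> $$ (i, j) / \<one>\<^bsub>G\<^esub> $$ (0, 0))"
    if ij: "i < n" "j < n" for i j
  proof -
    consider "i \<noteq> j" | "i = j" "i \<noteq> n - 1" | "i = j" "i = n - 1" by blast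
    then show ?thesis
    proof cases
      case 1
      then show ?thesis using ij n_pos by (simp add: B_def diagonal_entry one_G)
    next
      case 2
      have "\<forall>\<^sub>F k in sequentially. 1 = B k $$ (i, j) / B k $$ (0, 0)"
        unfolding B00 using ne by eventually_elim (use 2 ij in \<open>simp add: B_def diagonal_entry\<close>)
      then show ?thesis
        using 2 ij n_pos by (intro Lim_transform_eventually[OF tendsto_const]) (simp add: one_G)
    next
      case 3
      have "(\<lambda>k. inverse (a k ^ (n - 1)) / a k) \<longlonglongrightarrow> inverse (r ^ (n - 1)) / r"
        using a(2) \<open>r \<noteq> 0\<close> by (intro tendsto_intros) auto
      moreover have "inverse (r ^ (n - 1)) / r = inverse (r ^ n)"
        using n_pos by (cases n) (auto simp: field_simps)
      ultimately show ?thesis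
        using 3 ij n_pos rn unfolding B00 by (simp add: B_def diagonal_entry one_G)
    qed
  qed
  moreover have "(\<lambda>k. B k $$ (0, 0) ^ m) \<longlonglongrightarrow> \<one>\<^bsub>G\<^esub> $$ (0, 0) ^ m"
    using tendsto_power[OF a(2), of m] r n_pos unfolding B00 by (simp add: one_G)
  ultimately have "limitin (ratio_topology m) B \<one>\<^bsub>G\<^esub> sequentially"
    using evB by (simp add: limitin_ratio_topology_iff)
  then have "(\<lambda>k. B k $$ (0, 0)) \<longlonglongrightarrow> \<one>\<^bsub>G\<^esub> $$ (0, 0)"
    using n_pos unfolding eq limitin_T_iff by auto
  then have "a \<longlonglongrightarrow> 1" using n_pos unfolding B00 by (simp add: one_G)
  with a(2) r(2) LIMSEQ_unique show False by blast
qed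

end

section \<open>Roots of unity\<close>

lemma rho_power: "rho m ^ k = cis (2 * pi * real k / real m)"
proof -
  have "rho m = cis (2 * pi / real m)" by (simp add: rho_def cis_conv_exp mult_ac)
  then show ?thesis by (simp add: Complex.DeMoivre mult_ac)
qed

lemma rho_group_eq_roots_of_unity:
  assumes "m > 0"
  shows "rho_group m = {z. z ^ m = 1}"
proof (intro equalityI subsetI)
  have 1: "rho m ^ m = 1" unfolding rho_power using assms by simp
  fix z assume "z \<in> rho_group m"
  then obtain k :: int where "z = rho m powi k" by (auto simp: rho_group_def)
  then have "z ^ m = rho m powi (k * int m)"
    by (simp only: power_int_mult power_int_of_nat)
  also have "\<dots> = (rho m ^ m) powi k"
    by (simp only: mult.commute[of k] power_int_mult power_int_of_nat)
  finally have "z ^ m = (rho m ^ m) powi k" .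
  then show "z \<in> {z. z ^ m = 1}" by (simp add: 1)
next
  fix z :: complex assume "z \<in> {z. z ^ m = 1}"
  then obtain k where "z = cis (2 * pi * real k / real m)"
    using Complex.bij_betw_roots_unity[OF assms] by (auto simp: bij_betw_def)
  then have "z = rho m powi int k" by (simp add: rho_power)
  then show "z \<in> rho_group m" unfolding rho_group_def by (rule image_eqI) simp
qed

text \<open>The powers of \<open>z\<close> with exponent below its order \<open>m\<close> are distinct roots of \<open>w ^ m = 1\<close>, and that
  equation has only \<open>m\<close> solutions.\<close>

lemma root_of_unity_order:
  fixes z :: complex
  assumes "z ^ n = 1" "n > 0" "z \<noteq> 1"
  obtains m where "m > 1" "m dvd n" "\<And>w. w ^ m = 1 \<Longrightarrow> \<exists>k::nat. w = z ^ k"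
proof -
  define m where "m = (LEAST m. m > 0 \<and> z ^ m = 1)"
  have m: "m > 0" "z ^ m = 1"
    using LeastI[of "\<lambda>m. m > 0 \<and> z ^ m = 1" n] assms by (auto simp: m_def)
  have least: "\<not> z ^ k = 1" if "0 < k" "k < m" for k
    using not_less_Least[of k "\<lambda>m. m > 0 \<and> z ^ m = 1"] that by (auto simp: m_def)
  have "z ^ (n mod m) = 1"
  proof -
    have "z ^ n = (z ^ m) ^ (n div m) * z ^ (n mod m)"
      by (simp flip: power_mult power_add)
    with assms(1) m show ?thesis by simp
  qed
  with least[of "n mod m"] m have "m dvd n" by (metis dvd_eq_mod_eq_0 gr0I mod_less_divisor)
  moreover have "m > 1" using m assms(3) by (cases "m = 1") auto
  moreover have "(\<lambda>k. z ^ k) ` {..<m} = {w. w ^ m = 1}"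
  proof (rule card_subset_eq)
    show "finite {w :: complex. w ^ m = 1}" using m by (intro finite_roots_unity) auto
    show "(\<lambda>k. z ^ k) ` {..<m} \<subseteq> {w. w ^ m = 1}"
      using m by auto (metis mult.commute power_mult power_one)
    have "z \<noteq> 0" using m by (auto simp: power_0_left)
    have "inj_on (\<lambda>k. z ^ k) {..<m}"
    proof (rule linorder_inj_onI')
      fix i j assume ij: "i \<in> {..<m}" "j \<in> {..<m}" "i < j"
      have "z ^ j = z ^ i * z ^ (j - i)" using ij by (simp flip: power_add)
      moreover have "z ^ (j - i) \<noteq> 1" using ij by (intro least) auto
      ultimately show "z ^ i \<noteq> z ^ j" using \<open>z \<noteq> 0\<close> by auto
    qed
    then show "card ((\<lambda>k. z ^ k) ` {..<m}) = card {w :: complex. w ^ m = 1}"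
      using m by (simp add: card_image card_roots_unity_eq)
  qed
  then have "\<exists>k. w = z ^ k" if "w ^ m = 1" for w using that by blast
  ultimately show ?thesis using that by blast
qed

section \<open>The two cases of the theorem\<close>

text \<open>Both minimality claims come from the same condition: each nontrivial \<open>n\<close>-th root of unity in the
  closure of \<open>F\<close> has a nontrivial power in \<open>F\<close>. In the dense case that power is found among the
  \<open>m\<close>-th roots of unity for the order \<open>m\<close> of the root. In the real case the only candidate for
  the root is \<open>-1\<close>, which is in \<open>F\<close> already.\<close>

theorem corollary2p14:
  fixes F :: "complex set"
  assumes "subfield F (ring_of_type_algebra :: complex ring)"
  shows "(closure F = UNIV \<longrightarrow>
            (\<forall>n::nat. n \<ge> 1 \<longrightarrow>
               (minimal_topological_group (ST_plus n F) (ST_plus_topology n F) \<longleftrightarrow>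
                  (\<forall>m::nat. m > 1 \<and> m dvd n \<longrightarrow> rho_group m \<inter> F \<noteq> {1})))) \<and>
         (F \<subseteq> \<real> \<longrightarrow>
            (\<forall>n::nat. n \<ge> 1 \<longrightarrow>
               minimal_topological_group (ST_plus n F) (ST_plus_topology n F)))"
proof (intro conjI impI allI)
  interpret complex_subfield F by (rule complex_subfield.intro) (rule assms)
  have rho: "rho_group m \<inter> F \<noteq> {1} \<longleftrightarrow> (\<exists>z\<in>F. z ^ m = 1 \<and> z \<noteq> 1)" if "m > 1" for m
    using that one_mem by (auto simp: rho_group_eq_roots_of_unity)
  fix n :: nat assume n: "n \<ge> 1"
  interpret triangular_group F n by unfold_locales (rule n)
  {
    assume dense: "closure F = UNIV"
    show "minimal_topological_group G T \<longleftrightarrow> (\<forall>m::nat. m > 1 \<and> m dvd n \<longrightarrow> rho_group m \<inter> F \<noteq> {1})"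
    proof
      assume "minimal_topological_group G T"
      then show "\<forall>m::nat. m > 1 \<and> m dvd n \<longrightarrow> rho_group m \<inter> F \<noteq> {1}"
        using not_minimal_if_no_roots[OF dense] rho by blast
    next
      assume cond: "\<forall>m::nat. m > 1 \<and> m dvd n \<longrightarrow> rho_group m \<inter> F \<noteq> {1}"
      show "minimal_topological_group G T"
      proof (rule minimal_if_roots)
        fix z :: complex assume z: "z ^ n = 1" "z \<noteq> 1"
        obtain m where m: "m > 1" "m dvd n" "\<And>w. w ^ m = 1 \<Longrightarrow> \<exists>k::nat. w = z ^ k"
          using root_of_unity_order[OF z(1) _ z(2)] n by auto
        with cond rho obtain w where "w \<in> F" "w ^ m = 1" "w \<noteq> 1" by blast
        with m(3) show "\<exists>k::nat. z ^ k \<in> F \<and> z ^ k \<noteq> 1" by blast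
      qed
    qed
  next
    assume real: "F \<subseteq> \<real>"
    show "minimal_topological_group G T"
    proof (rule minimal_if_roots)
      fix z assume z: "z \<in> closure F" "z ^ n = 1" "z \<noteq> 1"
      have "z \<in> \<real>" using z(1) closure_minimal[OF real closed_complex_Reals] by blast
      moreover have "norm z = 1"
        using z(2) n by (metis power_eq_1_iff not_one_le_zero)
      ultimately have "z = -1" using z(3) by (auto elim!: Reals_cases simp: abs_if split: if_splits)
      then show "\<exists>k::nat. z ^ k \<in> F \<and> z ^ k \<noteq> 1"
        by (intro exI[of _ 1]) (simp add: field_mem)
    qed
  }
qed

end
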